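(* Let $\mathcal H$ be a real Hilbert space, $C\subseteq\mathcal H$ nonempty closed convex, and let $B\colon\mathcal H\to\mathcal H$ be monotone and $L$-Lipschitz with nonempty solution set $S$. Let $0\le\beta_n\le\bar\beta\le\tfrac14$ with $\sum_n\beta_n<\infty$, where $\bar\beta=\sup_n\beta_n$, let the step $\lambda>0$ be constant, $\Lambda=\lambda L$, set $\theta_n=1-\beta_n$, fix $x_{-1}=x_0=u_0\in C$, and let $(x_n)$ be generated by $$x_{n+1}=P_C\bigl(x_n-\lambda B(u_n)\bigr),\qquad u_n=x_n+\theta_n(x_n-x_{n-1})+\beta_n(x_n-u_{n-1}).$$ Define $$\mu^B_j:=2\Lambda\sum_{k\ge0}\bar\beta^{\,k}\beta_{j+1+k},\qquad j\ge0.$$ If $$\sum_{j\ge0}(\mu^B_j)^2\le\bigl(1-(1+\sqrt2)\Lambda\bigr)^2\qquad(\text{in particular }\Lambda<\sqrt2-1),\qquad(\ast)$$ then $(x_n)$ converges weakly to a point of $S$, with $\|x_{n+1}-x_n\|\to0$ and $\|u_n-x_n\|\to0$. For the filter $\beta_k=0.25/(k+1)^2$, condition $(\ast)$ holds for all $\Lambda\le0.387$ (the sharp cutoff being $\Lambda\approx0.3879$), and as $\bar\beta\to0$ the certified range approaches $(0,(\sqrt2-1)/L)$.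
   Context: $P_C$ is the metric projection onto $C$. Monotone means $\langle B(x)-B(y),x-y\rangle\ge0$ for all $x,y\in\mathcal H$; $L$-Lipschitz means $\|B(x)-B(y)\|\le L\|x-y\|$ for all $x,y\in\mathcal H$. The solution set is $S=\{z\in C:\langle B(z),x-z\rangle\ge0\ \forall x\in C\}$. The filter is the sequence $(\beta_n)_{n\ge0}$; the formula for $u_n$ is used for $n\ge1$, with $u_0=x_0$ given. The certified range is the range of step sizes $\lambda$ for which $(\ast)$ certifies convergence.
   Formalization: Λ<√2−1 is required as part of (∗), since the squared inequality does not imply it (β=0); the limit of the certified range as β̄→0 is stated uniformly over filters with Σβ_n≤K for each fixed K, L>0, since it fails for arbitrary filters. *)

theory Defs
  imports "HOL-Analysis.Analysis"
begin

text \<open>Real Hilbert spaces are types of class \<open>real_inner\<close> and \<open>complete_space\<close>; the library's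
  \<open>closest_point\<close> additionally requires \<open>heine_borel\<close>, hence is restricted to locally compact
  spaces and cannot be used here.\<close>

definition metric_projection :: "'a::real_normed_vector set \<Rightarrow> 'a \<Rightarrow> 'a" where
  "metric_projection C a = arg_min_on (dist a) C"

definition monotone_operator :: "('a::real_inner \<Rightarrow> 'a) \<Rightarrow> bool" where
  "monotone_operator B \<longleftrightarrow> (\<forall>x y. (B x - B y) \<bullet> (x - y) \<ge> 0)"

definition VI_solutions :: "'a::real_inner set \<Rightarrow> ('a \<Rightarrow> 'a) \<Rightarrow> 'a set" where
  "VI_solutions C B = {z \<in> C. \<forall>x\<in>C. B z \<bullet> (x - z) \<ge> 0}"

definition weakly_converges_to :: "(nat \<Rightarrow> 'a::real_normed_vector) \<Rightarrow> 'a \<Rightarrow> bool" where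
  "weakly_converges_to x p \<longleftrightarrow>
     (\<forall>f :: 'a \<Rightarrow> real. bounded_linear f \<longrightarrow> (\<lambda>n. f (x n)) \<longlonglongrightarrow> f p)"

definition filter_sup :: "(nat \<Rightarrow> real) \<Rightarrow> real" where
  "filter_sup \<beta> = (SUP n. \<beta> n)"

definition admissible_filter :: "(nat \<Rightarrow> real) \<Rightarrow> bool" where
  "admissible_filter \<beta> \<longleftrightarrow> (\<forall>n. 0 \<le> \<beta> n \<and> \<beta> n \<le> 1/4) \<and> summable \<beta>"

text \<open>Since the formula for \<open>u n\<close> is used for \<open>n \<ge> 1\<close> only, \<open>x\<^sub>-\<^sub>1\<close> (equal to \<open>x 0\<close>) never
  enters the recursion.  The weight \<open>1 - \<beta> n\<close> is \<open>\<theta>\<^sub>n\<close>.\<close>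

definition filtered_iteration ::
  "'a::real_inner set \<Rightarrow> ('a \<Rightarrow> 'a) \<Rightarrow> real \<Rightarrow> (nat \<Rightarrow> real) \<Rightarrow> (nat \<Rightarrow> 'a) \<Rightarrow> (nat \<Rightarrow> 'a) \<Rightarrow> bool" where
  "filtered_iteration C B lam \<beta> x u \<longleftrightarrow>
     x 0 \<in> C \<and> u 0 = x 0 \<and>
     (\<forall>n. x (Suc n) = metric_projection C (x n - lam *\<^sub>R B (u n))) \<and>
     (\<forall>n\<ge>1. u n = x n + (1 - \<beta> n) *\<^sub>R (x n - x (n - 1)) + \<beta> n *\<^sub>R (x n - u (n - 1)))"

definition muB :: "(nat \<Rightarrow> real) \<Rightarrow> real \<Rightarrow> nat \<Rightarrow> real" where
  "muB \<beta> \<Lambda> j = 2 * \<Lambda> * (\<Sum>k. filter_sup \<beta> ^ k * \<beta> (j + 1 + k))"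

text \<open>The requirement \<open>\<Lambda> < sqrt 2 - 1\<close> has to be part of the condition: the squared inequality does
  not imply it, and for \<open>\<beta> = 0\<close> that inequality alone holds for every \<open>\<Lambda>\<close>.  For an admissible
  filter both series converge.\<close>

definition certificate :: "(nat \<Rightarrow> real) \<Rightarrow> real \<Rightarrow> bool" where
  "certificate \<beta> \<Lambda> \<longleftrightarrow>
     \<Lambda> < sqrt 2 - 1 \<and> (\<Sum>j. (muB \<beta> \<Lambda> j)\<^sup>2) \<le> (1 - (1 + sqrt 2) * \<Lambda>)\<^sup>2"

definition certified_range :: "(nat \<Rightarrow> real) \<Rightarrow> real \<Rightarrow> real set" where
  "certified_range \<beta> L = {lam. lam > 0 \<and> certificate \<beta> (lam * L)}"

definition quadratic_filter :: "nat \<Rightarrow> real" where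
  "quadratic_filter k = 0.25 / (real k + 1)\<^sup>2"

end

theory Submission
  imports Defs
begin

text \<open>Since \<open>u\<^sub>n = 2 x\<^sub>n - x\<^sub>n\<^sub>-\<^sub>1 - \<beta>\<^sub>n (u\<^sub>n\<^sub>-\<^sub>1 - x\<^sub>n\<^sub>-\<^sub>1)\<close>, the scheme is the projected reflected
  gradient method with an error of relative size \<open>\<beta>\<^sub>n\<close>.  As \<open>\<beta>\<close> is summable, its tails are small
  and the strict inequality \<open>\<Lambda> < sqrt 2 - 1\<close> leaves room to absorb this error: for each solution
  \<open>z\<close>, a Lyapunov function made of \<open>\<parallel>x\<^sub>n - z\<parallel>\<^sup>2\<close>, \<open>\<parallel>x\<^sub>n - u\<^sub>n\<^sub>-\<^sub>1\<parallel>\<^sup>2\<close>, \<open>\<parallel>u\<^sub>n - x\<^sub>n\<parallel>\<^sup>2\<close> and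
  \<open>\<langle>B z, x\<^sub>n - z\<rangle>\<close> decreases up to factors \<open>1 + 2 \<beta>\<^sub>n\<close>.  Opial's argument and Minty's lemma then give
  weak convergence.  For a fixed filter, \<open>\<mu>\<^sup>B\<^sub>j = 2 \<Lambda> w\<^sub>j\<close> and the certificate reads
  \<open>\<Lambda> \<le> 1 / (1 + sqrt 2 + 2 sqrt W)\<close> with \<open>W = \<Sum>\<^sub>j w\<^sub>j\<^sup>2\<close>.  Here \<open>W\<close> is at most
  \<open>16/9 sup \<beta> \<Sum>\<beta>\<close>, which vanishes in the limit, and for the quadratic filter it is enclosed
  numerically.\<close>

section \<open>Projection, duality and weak compactness in Hilbert spaces\<close>

text \<open>Completeness takes the place of compactness: the sets \<open>S n\<close> of
  near-minimisers are closed and nested, and the parallelogram law shrinks their diameters to zero,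
  so Cantor's intersection argument yields a minimiser.\<close>

lemma hilbert_nearest_point_exists:
  fixes C :: "'a::{real_inner, complete_space} set"
  assumes "C \<noteq> {}" "closed C" "convex C"
  obtains p where "p \<in> C" "\<And>y. y \<in> C \<Longrightarrow> dist a p \<le> dist a y"
proof -
  define d where "d = (INF y\<in>C. (dist a y)\<^sup>2)"
  define S where "S n = {y \<in> C. (dist a y)\<^sup>2 \<le> d + 1 / real (Suc n)}" for n
  have bdd: "bdd_below ((\<lambda>y. (dist a y)\<^sup>2) ` C)"
    by (intro bdd_belowI[of _ 0]) auto
  have d_le: "d \<le> (dist a y)\<^sup>2" if "y \<in> C" for y
    unfolding d_def using bdd that by (rule cINF_lower)
  have cl: "closed (S n)" for n
  proof -
    have "S n = C \<inter> {y. (dist a y)\<^sup>2 \<le> d + 1 / real (Suc n)}" by (auto simp: S_def)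
    moreover have "closed {y. (dist a y)\<^sup>2 \<le> d + 1 / real (Suc n)}"
      by (intro closed_Collect_le continuous_intros)
    ultimately show ?thesis using assms(2) by (simp add: closed_Int)
  qed
  have ne: "S n \<noteq> {}" for n
  proof -
    have "d < d + 1 / real (Suc n)" by simp
    then obtain y where "y \<in> C" "(dist a y)\<^sup>2 < d + 1 / real (Suc n)"
      unfolding d_def cINF_less_iff[OF assms(1) bdd] by blast
    then have "y \<in> S n" by (simp add: S_def)
    then show ?thesis by blast
  qed
  have decr: "S n \<subseteq> S m" if "m \<le> n" for m n
  proof -
    have "1 / real (Suc n) \<le> 1 / real (Suc m)" using that by (simp add: field_simps)
    then show ?thesis by (auto simp: S_def)
  qed
  have diam: "(dist y z)\<^sup>2 \<le> 4 / real (Suc n)" if "y \<in> S n" "z \<in> S n" for y z n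
  proof -
    have "(1/2) *\<^sub>R y + (1/2) *\<^sub>R z \<in> C"
      using that assms(3) by (auto simp: S_def intro!: convexD)
    then have "d \<le> (dist a ((1/2) *\<^sub>R y + (1/2) *\<^sub>R z))\<^sup>2" by (rule d_le)
    \<comment> \<open>Parallelogram law. Since the midpoint is no closer to \<open>a\<close> than
      \<open>d\<close> allows, the squared diameter is at most four times the excess
      \<open>1 / real (Suc n)\<close>.\<close>
    moreover have "(dist y z)\<^sup>2 = 2 * (dist a y)\<^sup>2 + 2 * (dist a z)\<^sup>2
        - 4 * (dist a ((1/2) *\<^sub>R y + (1/2) *\<^sub>R z))\<^sup>2"
      by (simp add: dist_norm power2_norm_eq_inner inner_simps inner_commute algebra_simps)
    moreover have "(dist a y)\<^sup>2 \<le> d + 1 / real (Suc n)" "(dist a z)\<^sup>2 \<le> d + 1 / real (Suc n)"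
      using that by (auto simp: S_def)
    ultimately show ?thesis by simp
  qed
  have small: "\<exists>n. \<forall>y\<in>S n. \<forall>z\<in>S n. dist y z < \<epsilon>" if "\<epsilon> > 0" for \<epsilon>
  proof -
    have "0 < \<epsilon>\<^sup>2 / 4" using that by simp
    then obtain n where n: "inverse (real (Suc n)) < \<epsilon>\<^sup>2 / 4" using reals_Archimedean by blast
    have "dist y z < \<epsilon>" if "y \<in> S n" "z \<in> S n" for y z
    proof -
      have "4 / real (Suc n) < \<epsilon>\<^sup>2" using n by (simp add: field_simps)
      with diam[OF that] have "(dist y z)\<^sup>2 < \<epsilon>\<^sup>2" by (rule order.strict_trans1)
      then show ?thesis using \<open>\<epsilon> > 0\<close> by (simp add: power2_less_imp_less)
    qed
    then show ?thesis by blast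
  qed
  obtain p where p: "\<And>n. p \<in> S n"
    using decreasing_closed_nest[of S, OF cl ne decr small] by blast
  have "(\<lambda>n. d + 1 / real (Suc n)) \<longlonglongrightarrow> d + 0"
    by (intro tendsto_intros LIMSEQ_Suc[OF lim_1_over_n])
  then have "(dist a p)\<^sup>2 \<le> d"
    using p by (intro LIMSEQ_le_const) (auto simp: S_def)
  then have "dist a p \<le> dist a y" if "y \<in> C" for y
    using d_le[OF that] by (meson order_trans power2_le_imp_le zero_le_dist)
  moreover have "p \<in> C" using p[of 0] by (simp add: S_def)
  ultimately show ?thesis using that by blast
qed

text \<open>\<open>metric_projection\<close> is a Hilbert choice among minimisers, so the existence
  of one minimiser is what gives the chosen point its properties.\<close>

lemma metric_projection_properties:
  fixes C :: "'a::{real_inner, complete_space} set"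
  assumes "C \<noteq> {}" "closed C" "convex C"
  shows metric_projection_in: "metric_projection C a \<in> C"
    and metric_projection_le: "y \<in> C \<Longrightarrow> dist a (metric_projection C a) \<le> dist a y"
proof -
  obtain p where "p \<in> C" "\<And>y. y \<in> C \<Longrightarrow> dist a p \<le> dist a y"
    using hilbert_nearest_point_exists[OF assms] by blast
  then have "is_arg_min (dist a) (\<lambda>x. x \<in> C) p"
    by (auto simp: is_arg_min_def not_less)
  then have "is_arg_min (dist a) (\<lambda>x. x \<in> C) (metric_projection C a)"
    unfolding metric_projection_def arg_min_on_def arg_min_def by (rule someI)
  then show "metric_projection C a \<in> C"
    "y \<in> C \<Longrightarrow> dist a (metric_projection C a) \<le> dist a y"
    by (auto simp: is_arg_min_def not_less)
qed

text \<open>First-order optimality: moving from the projection towards \<open>y\<close> cannot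
  reduce the distance to \<open>a\<close>. Dividing the resulting quadratic inequality by
  \<open>t\<close> and letting \<open>t\<close> tend to 0 from the right leaves the linear
  term.\<close>

lemma metric_projection_obtuse:
  fixes C :: "'a::{real_inner, complete_space} set"
  assumes "C \<noteq> {}" "closed C" "convex C" "y \<in> C"
  shows "(metric_projection C a - a) \<bullet> (y - metric_projection C a) \<ge> 0"
proof -
  define p where "p = metric_projection C a"
  have pC: "p \<in> C" unfolding p_def using assms by (intro metric_projection_in)
  have "0 \<le> 2 * ((p - a) \<bullet> (y - p)) + t * (norm (y - p))\<^sup>2" if t: "0 < t" "t \<le> 1" for t :: real
  proof -
    have "(1 - t) *\<^sub>R p + t *\<^sub>R y \<in> C"
      using assms(3,4) pC t by (auto intro!: convexD)
    also have "(1 - t) *\<^sub>R p + t *\<^sub>R y = p + t *\<^sub>R (y - p)" by (simp add: algebra_simps)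
    finally have "dist a p \<le> dist a (p + t *\<^sub>R (y - p))"
      unfolding p_def using assms(1-3) by (intro metric_projection_le)
    then have "(norm (p - a))\<^sup>2 \<le> (norm ((p - a) + t *\<^sub>R (y - p)))\<^sup>2"
      by (intro power_mono) (simp_all add: dist_norm norm_minus_commute algebra_simps)
    also have "\<dots> = (norm (p - a))\<^sup>2 + t * (2 * ((p - a) \<bullet> (y - p)) + t * (norm (y - p))\<^sup>2)"
      unfolding power2_norm_eq_inner
      by (simp only: inner_add_left inner_add_right inner_scaleR_left inner_scaleR_right
            inner_commute[of "y - p" "p - a"]) (simp add: algebra_simps)
    finally have "0 \<le> t * (2 * ((p - a) \<bullet> (y - p)) + t * (norm (y - p))\<^sup>2)" by simp
    then show ?thesis using t by (simp add: zero_le_mult_iff)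
  qed
  then have "eventually (\<lambda>t. 0 \<le> 2 * ((p - a) \<bullet> (y - p)) + t * (norm (y - p))\<^sup>2) (at_right (0::real))"
    by (intro eventually_at_rightI[of 0 1]) auto
  moreover have "((\<lambda>t. 2 * ((p - a) \<bullet> (y - p)) + t * (norm (y - p))\<^sup>2) \<longlongrightarrow>
      2 * ((p - a) \<bullet> (y - p)) + 0 * (norm (y - p))\<^sup>2) (at_right (0::real))"
    by (intro tendsto_intros)
  ultimately have "0 \<le> 2 * ((p - a) \<bullet> (y - p)) + 0 * (norm (y - p))\<^sup>2"
    by (intro tendsto_lowerbound[OF _ _ trivial_limit_at_right_real])
  then show ?thesis by (simp add: p_def)
qed

section \<open>Riesz representation, weak limits and Opial's argument\<close>

text \<open>If \<open>f v\<close> is nonzero, the residual \<open>w\<close> of projecting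
  \<open>v\<close> onto the kernel is orthogonal to the kernel, and every vector is a kernel element
  plus a multiple of \<open>w\<close>.\<close>

lemma riesz_representation:
  fixes f :: "'a::{real_inner, complete_space} \<Rightarrow> real"
  assumes "bounded_linear f"
  obtains p where "\<And>y. f y = p \<bullet> y"
proof (cases "\<forall>y. f y = 0")
  case True
  then show ?thesis using that[of 0] by simp
next
  case False
  then obtain v where v: "f v \<noteq> 0" by blast
  interpret bounded_linear f by fact
  define K where "K = {y. f y = 0}"
  have K: "K \<noteq> {}" "closed K" "convex K"
  proof -
    show "K \<noteq> {}" unfolding K_def using zero by blast
    show "closed K" unfolding K_def
      by (intro closed_Collect_eq linear_continuous_on assms continuous_intros)
    show "convex K" unfolding K_def by (auto simp: convex_def add scale)
  qed
  define q where "q = metric_projection K v"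
  define w where "w = v - q"
  have q: "f q = 0" using metric_projection_in[OF K, of v] by (simp add: K_def q_def)
  have fw: "f w = f v" by (simp add: w_def diff q)
  have le: "0 \<le> - (w \<bullet> k)" if "f k = 0" for k
  proof -
    have "q + k \<in> K" using that q by (simp add: K_def add)
    from metric_projection_obtuse[OF K this, of v] show ?thesis
      by (simp add: q_def[symmetric] w_def inner_diff_left)
  qed
  have orth: "w \<bullet> k = 0" if "f k = 0" for k
    using le[OF that] le[of "- k"] that by (simp add: neg)
  have "w \<noteq> 0" using fw v zero by auto
  then have ww: "w \<bullet> w \<noteq> 0" by simp
  have "f y = ((f w / (w \<bullet> w)) *\<^sub>R w) \<bullet> y" for y
  proof -
    have "f (y - (f y / f w) *\<^sub>R w) = 0" using fw v by (simp add: diff scale)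
    from orth[OF this] have "w \<bullet> y = (f y / f w) * (w \<bullet> w)" by (simp add: inner_diff_right)
    then show ?thesis using ww fw v by (simp add: field_simps)
  qed
  then show ?thesis using that by blast
qed

text \<open>Weak compactness of balls, in terms of filters: Tychonoff's theorem for the maps
  \<open>y \<mapsto> x i \<bullet> y\<close> in the product space \<open>\<Prod>y. [- M \<parallel>y\<parallel>, M \<parallel>y\<parallel>]\<close>.\<close>

lemma bounded_imp_weak_cluster_point:
  fixes x :: "'i \<Rightarrow> 'a::{real_inner, complete_space}"
  assumes "F \<noteq> bot" and M: "\<And>i. norm (x i) \<le> M"
  shows "\<exists>G p. G \<noteq> bot \<and> G \<le> F \<and> (\<forall>y. ((\<lambda>i. x i \<bullet> y) \<longlongrightarrow> p \<bullet> y) G)"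
proof -
  define X where "X i = (\<lambda>y. x i \<bullet> y)" for i
  define K where "K = (\<Pi>\<^sub>E y\<in>(UNIV :: 'a set). {- (M * norm y) .. M * norm y})"
  have "compactin (product_topology (\<lambda>_. euclidean) UNIV) K"
    unfolding K_def by (subst compactin_PiE) auto
  then have "compact K" by (simp add: euclidean_product_topology)
  have XK: "X i \<in> K" for i
  proof -
    have "\<bar>x i \<bullet> y\<bar> \<le> M * norm y" for y
      using Cauchy_Schwarz_ineq2[of "x i" y] M[of i] mult_right_mono[of "norm (x i)" M "norm y"]
      by auto
    then have "- (M * norm y) \<le> x i \<bullet> y \<and> x i \<bullet> y \<le> M * norm y" for y
      by (metis abs_le_iff minus_le_iff)
    then show ?thesis by (auto simp: K_def X_def)
  qed
  then obtain g where g: "g \<in> K" "inf (nhds g) (filtermap X F) \<noteq> bot"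
    using \<open>compact K\<close> assms(1) unfolding compact_filter
    by (metis (mono_tags, lifting) always_eventually eventually_filtermap filtermap_bot_iff)
  \<comment> \<open>The cluster point lives in the function space; \<open>G\<close> pulls its
    neighbourhoods back to the indices. It is proper, since otherwise \<open>X\<close> would
    eventually avoid a neighbourhood of \<open>g\<close>.\<close>
  define G where "G = inf F (filtercomap X (nhds g))"
  have "G \<noteq> bot"
  proof
    assume "G = bot"
    then have "eventually (\<lambda>_. False) G" by simp
    then obtain P Q where PQ: "eventually P F" "eventually Q (filtercomap X (nhds g))"
      "\<And>i. P i \<Longrightarrow> Q i \<Longrightarrow> False"
      unfolding G_def eventually_inf by blast
    then obtain R where R: "eventually R (nhds g)" "\<And>i. R (X i) \<Longrightarrow> Q i"
      unfolding eventually_filtercomap by blast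
    have "eventually (\<lambda>h. \<not> R h) (filtermap X F)"
      unfolding eventually_filtermap using PQ(1) by eventually_elim (use PQ R in blast)
    with R(1) have "eventually (\<lambda>_. False) (inf (nhds g) (filtermap X F))"
      unfolding eventually_inf by blast
    then show False using g(2) by (simp add: trivial_limit_def)
  qed
  have "(X \<longlongrightarrow> g) G"
    unfolding G_def by (rule tendsto_mono[OF inf_le2 filterlim_filtercomap])
  then have lim: "((\<lambda>i. x i \<bullet> y) \<longlongrightarrow> g y) G" for y
    using continuous_on_tendsto_compose[OF continuous_on_product_coordinates, of X g G y]
    by (simp add: X_def)
  \<comment> \<open>Pointwise limits preserve linearity and membership in \<open>K\<close> gives the
    bound \<open>M\<close>, so Riesz representation turns \<open>g\<close> into a point
    \<open>p\<close>.\<close>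
  have "bounded_linear g"
  proof (rule bounded_linear_intro[where K = M])
    show "g (y + z) = g y + g z" for y z
      using tendsto_unique[OF \<open>G \<noteq> bot\<close> lim[of "y + z"] tendsto_add[OF lim[of y] lim[of z], folded inner_add_right]] .
    show "g (r *\<^sub>R y) = r *\<^sub>R g y" for r y
      using tendsto_unique[OF \<open>G \<noteq> bot\<close> lim[of "r *\<^sub>R y"] tendsto_mult_left[OF lim[of y], of r, folded inner_scaleR_right]]
      by simp
    show "norm (g y) \<le> norm y * M" for y
      using g(1) by (auto simp: K_def PiE_iff abs_le_iff mult.commute dest!: spec[of _ y])
  qed
  then obtain p where "\<And>y. g y = p \<bullet> y" using riesz_representation by blast
  then show ?thesis
    using \<open>G \<noteq> bot\<close> lim by (intro exI[of _ G] exI[of _ p]) (simp add: G_def)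
qed

text \<open>The obtuse-angle inequality at the projection \<open>q\<close> of \<open>p\<close>,
  tested at \<open>x i\<close>, is affine in \<open>x i\<close>. It passes to the weak limit and
  forces \<open>q = p\<close>.\<close>

lemma closed_convex_weakly_closed:
  fixes C :: "'a::{real_inner, complete_space} set"
  assumes "closed C" "convex C" "G \<noteq> bot" "\<And>i. x i \<in> C"
    and lim: "\<And>y. ((\<lambda>i. x i \<bullet> y) \<longlongrightarrow> p \<bullet> y) G"
  shows "p \<in> C"
proof -
  have "C \<noteq> {}" using assms(4) by auto
  note C = this assms(1,2)
  define q where "q = metric_projection C p"
  have "0 \<le> x i \<bullet> (q - p) - q \<bullet> (q - p)" for i
    using metric_projection_obtuse[OF C assms(4), of p i]
    unfolding q_def[symmetric] by (metis inner_commute inner_diff_left)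
  moreover have "((\<lambda>i. x i \<bullet> (q - p) - q \<bullet> (q - p)) \<longlongrightarrow> p \<bullet> (q - p) - q \<bullet> (q - p)) G"
    by (intro tendsto_intros lim)
  ultimately have "0 \<le> p \<bullet> (q - p) - q \<bullet> (q - p)"
    by (intro tendsto_lowerbound[OF _ _ assms(3)]) auto
  then have "(q - p) \<bullet> (q - p) \<le> 0" by (simp add: inner_diff_left)
  then have "q = p" using inner_ge_zero[of "q - p"] by (simp add: antisym)
  then show ?thesis using metric_projection_in[OF C, of p] by (simp add: q_def)
qed

text \<open>Converging distances to \<open>S\<close> bound the sequence, so weak cluster points
  exist; they lie in \<open>S\<close> and, by Opial's argument, any two coincide. Weak compactness
  then upgrades this to convergence of the whole sequence.\<close>

lemma opial_weak_convergence:
  fixes x :: "nat \<Rightarrow> 'a::{real_inner, complete_space}"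
  assumes "S \<noteq> {}"
    and fejer: "\<And>z. z \<in> S \<Longrightarrow> convergent (\<lambda>n. (norm (x n - z))\<^sup>2)"
    and clus: "\<And>G p. G \<noteq> bot \<Longrightarrow> G \<le> sequentially \<Longrightarrow>
      (\<And>y. ((\<lambda>n. x n \<bullet> y) \<longlongrightarrow> p \<bullet> y) G) \<Longrightarrow> p \<in> S"
  shows "\<exists>p\<in>S. weakly_converges_to x p"
proof -
  obtain z where "z \<in> S" using assms(1) by blast
  then have "Bseq (\<lambda>n. (norm (x n - z))\<^sup>2)"
    using fejer convergent_imp_Bseq by blast
  then obtain c where c: "\<And>n. norm ((norm (x n - z))\<^sup>2) \<le> c" by (auto simp: Bseq_def)
  define M where "M = sqrt c + norm z"
  have M: "norm (x n) \<le> M" for n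
  proof -
    have "norm (x n - z) \<le> sqrt c" using c[of n] by (intro real_le_rsqrt) simp
    then show ?thesis unfolding M_def using norm_triangle_sub[of "x n" z] by simp
  qed
  have unique: "p = q"
    if "G \<noteq> bot" "G \<le> sequentially" "\<And>y. ((\<lambda>n. x n \<bullet> y) \<longlongrightarrow> p \<bullet> y) G"
      "G' \<noteq> bot" "G' \<le> sequentially" "\<And>y. ((\<lambda>n. x n \<bullet> y) \<longlongrightarrow> q \<bullet> y) G'" for G G' p q
  proof -
    \<comment> \<open>Subtracting the two convergent squared distances cancels the quadratic term
      and leaves an affine function of \<open>x n\<close>. Its limits along \<open>G\<close> and
      \<open>G'\<close> must agree, and their difference is twice the squared norm of
      \<open>p - q\<close>.\<close>
    have "p \<in> S" "q \<in> S" using clus that by blast+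
    then obtain l where "(\<lambda>n. (norm (x n - q))\<^sup>2 - (norm (x n - p))\<^sup>2) \<longlonglongrightarrow> l"
      using fejer convergent_diff unfolding convergent_def by blast
    moreover have "(norm (x n - q))\<^sup>2 - (norm (x n - p))\<^sup>2
        = 2 * (x n \<bullet> (p - q)) + (q \<bullet> q - p \<bullet> p)" for n
      by (simp add: power2_norm_eq_inner inner_simps inner_commute)
    ultimately have lim: "(\<lambda>n. 2 * (x n \<bullet> (p - q)) + (q \<bullet> q - p \<bullet> p)) \<longlonglongrightarrow> l" by simp
    have "((\<lambda>n. 2 * (x n \<bullet> (p - q)) + (q \<bullet> q - p \<bullet> p)) \<longlongrightarrow> 2 * (p \<bullet> (p - q)) + (q \<bullet> q - p \<bullet> p)) G"
      "((\<lambda>n. 2 * (x n \<bullet> (p - q)) + (q \<bullet> q - p \<bullet> p)) \<longlongrightarrow> 2 * (q \<bullet> (p - q)) + (q \<bullet> q - p \<bullet> p)) G'"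
      by (intro tendsto_intros that)+
    then have "2 * (p \<bullet> (p - q)) + (q \<bullet> q - p \<bullet> p) = l"
      "2 * (q \<bullet> (p - q)) + (q \<bullet> q - p \<bullet> p) = l"
      using tendsto_unique[OF \<open>G \<noteq> bot\<close> _ tendsto_mono[OF \<open>G \<le> sequentially\<close> lim]]
        tendsto_unique[OF \<open>G' \<noteq> bot\<close> _ tendsto_mono[OF \<open>G' \<le> sequentially\<close> lim]] by blast+
    then have "(p - q) \<bullet> (p - q) = 0" by (simp add: inner_diff_left)
    then show ?thesis by simp
  qed
  obtain G p where G: "G \<noteq> bot" "G \<le> sequentially" "\<forall>y. ((\<lambda>n. x n \<bullet> y) \<longlongrightarrow> p \<bullet> y) G"
    using bounded_imp_weak_cluster_point[where x = x, OF sequentially_bot M] by blast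
  have "(\<lambda>n. x n \<bullet> y) \<longlonglongrightarrow> p \<bullet> y" for y
  proof (rule ccontr)
    assume "\<not> (\<lambda>n. x n \<bullet> y) \<longlonglongrightarrow> p \<bullet> y"
    then obtain e where e: "e > 0" "\<not> eventually (\<lambda>n. dist (x n \<bullet> y) (p \<bullet> y) < e) sequentially"
      by (auto simp: tendsto_iff)
    \<comment> \<open>Restricting to the indices that stay \<open>e\<close> away from the limit
      still leaves a weak cluster point, which must again be \<open>p\<close>.\<close>
    define F where "F = inf sequentially (principal {n. \<not> dist (x n \<bullet> y) (p \<bullet> y) < e})"
    have "F \<noteq> bot"
      using e(2) by (auto simp: F_def trivial_limit_def eventually_inf_principal)
    then obtain G' q where G': "G' \<noteq> bot" "G' \<le> F" "\<forall>y. ((\<lambda>n. x n \<bullet> y) \<longlongrightarrow> q \<bullet> y) G'"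
      using bounded_imp_weak_cluster_point[where x = x, OF _ M] by blast
    have "G' \<le> sequentially" using G'(2) by (simp add: F_def)
    then have "q = p" using unique[of G' q G p] G G' by simp
    then have "eventually (\<lambda>n. dist (x n \<bullet> y) (p \<bullet> y) < e) G'"
      using G'(3) e(1) by (simp add: tendsto_iff)
    moreover have "eventually (\<lambda>n. \<not> dist (x n \<bullet> y) (p \<bullet> y) < e) G'"
      using G'(2) by (auto simp: F_def le_principal)
    ultimately have "eventually (\<lambda>n. False) G'" by eventually_elim simp
    then show False using G'(1) by (simp add: trivial_limit_def)
  qed
  then have "weakly_converges_to x p"
    unfolding weakly_converges_to_def by (auto elim!: riesz_representation simp: inner_commute)
  moreover have "p \<in> S" using clus[of G p] G by simp
  ultimately show ?thesis by blast
qed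

section \<open>Energy estimates\<close>

text \<open>One step with \<open>x\<^sub>0, x\<^sub>1, x\<^sub>2\<close> three consecutive iterates,
  \<open>u\<^sub>0, u\<^sub>1\<close> the extrapolated points and
  \<open>w\<^sub>0, w\<^sub>1, w\<close> the values of the operator at \<open>u\<^sub>0\<close>,
  \<open>u\<^sub>1\<close> and the solution \<open>z\<close>. \<open>P1\<close> to \<open>P3\<close>
  are obtuse-angle inequalities: \<open>x\<^sub>1\<close> tested at \<open>x\<^sub>2\<close> and
  \<open>x\<^sub>0\<close>, and \<open>x\<^sub>2\<close> tested at \<open>z\<close>. The filter
  enters as an error proportional to \<open>b\<close>.\<close>

lemma reflected_gradient_step:
  fixes x\<^sub>0 x\<^sub>1 x\<^sub>2 u\<^sub>0 u\<^sub>1 z w\<^sub>0 w\<^sub>1 w :: "'a::real_inner" and b lam L \<Lambda> \<kappa> :: real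
  assumes P1: "(x\<^sub>1 - x\<^sub>0 + lam *\<^sub>R w\<^sub>0) \<bullet> (x\<^sub>2 - x\<^sub>1) \<ge> 0"
    and P2: "(x\<^sub>1 - x\<^sub>0 + lam *\<^sub>R w\<^sub>0) \<bullet> (x\<^sub>0 - x\<^sub>1) \<ge> 0"
    and P3: "(x\<^sub>2 - x\<^sub>1 + lam *\<^sub>R w\<^sub>1) \<bullet> (z - x\<^sub>2) \<ge> 0"
    and u1: "u\<^sub>1 = x\<^sub>1 + (x\<^sub>1 - x\<^sub>0) - b *\<^sub>R (u\<^sub>0 - x\<^sub>0)"
    and mono: "(w\<^sub>1 - w) \<bullet> (u\<^sub>1 - z) \<ge> 0"
    and lip1: "norm (w\<^sub>1 - w\<^sub>0) \<le> L * norm (u\<^sub>1 - u\<^sub>0)"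
    and lip0: "norm (w\<^sub>0 - w) \<le> L * norm (u\<^sub>0 - z)"
    and b: "0 \<le> b" and lam: "lam > 0" and \<Lambda>: "\<Lambda> = lam * L" "0 \<le> \<Lambda>" "\<Lambda> \<le> 1/2"
    and \<kappa>: "\<kappa> = 1 - (1 + sqrt 2) * \<Lambda>"
  shows "(norm (x\<^sub>2 - z))\<^sup>2 + \<Lambda> * (norm (x\<^sub>2 - u\<^sub>1))\<^sup>2 + 2 * lam * (w \<bullet> (x\<^sub>1 - z))
     \<le> (norm (x\<^sub>1 - z))\<^sup>2 + \<Lambda> * (norm (x\<^sub>1 - u\<^sub>0))\<^sup>2 + 2 * lam * (w \<bullet> (x\<^sub>0 - z))
       - \<kappa> * (norm (x\<^sub>1 - x\<^sub>0))\<^sup>2 - \<kappa> * (norm (x\<^sub>2 - u\<^sub>1))\<^sup>2 - 2 * lam * (w \<bullet> (x\<^sub>1 - z))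
       + b * (2 * (norm (x\<^sub>2 - u\<^sub>1))\<^sup>2 + 5 * (norm (u\<^sub>0 - x\<^sub>0))\<^sup>2 + (norm (x\<^sub>0 - z))\<^sup>2)"
proof -
  define d where "d = norm (x\<^sub>1 - x\<^sub>0)"
  define s where "s = norm (x\<^sub>2 - u\<^sub>1)"
  define t where "t = norm (x\<^sub>1 - u\<^sub>0)"
  define e where "e = norm (u\<^sub>0 - x\<^sub>0)"
  define D where "D = norm (x\<^sub>0 - z)"
  have nonneg: "0 \<le> d" "0 \<le> s" "0 \<le> t" "0 \<le> e" "0 \<le> D"
    by (simp_all add: d_def s_def t_def e_def D_def)
  have energy: "(norm (x\<^sub>2 - z))\<^sup>2 \<le> (norm (x\<^sub>1 - z))\<^sup>2 - d\<^sup>2 - s\<^sup>2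
      - 2 * lam * ((w\<^sub>1 - w\<^sub>0) \<bullet> (x\<^sub>2 - u\<^sub>1)) - 2 * lam * (w \<bullet> (2 *\<^sub>R (x\<^sub>1 - z) - (x\<^sub>0 - z)))
      + 2 * b * ((x\<^sub>2 - u\<^sub>1) \<bullet> (u\<^sub>0 - x\<^sub>0)) - 2 * b * lam * ((w\<^sub>0 - w) \<bullet> (u\<^sub>0 - x\<^sub>0))"
  proof -
    have m: "0 \<le> lam * ((w\<^sub>1 - w) \<bullet> (u\<^sub>1 - z))" using mono lam by simp
    have bb: "0 \<le> (b *\<^sub>R (u\<^sub>0 - x\<^sub>0)) \<bullet> (b *\<^sub>R (u\<^sub>0 - x\<^sub>0))" by (rule inner_ge_zero)
    \<comment> \<open>An exact identity: the gap between the two sides of the energy inequality is a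
      sum of terms that the projection inequalities, monotonicity and a square make
      nonnegative.\<close>
    have "(norm (x\<^sub>1 - z))\<^sup>2 - d\<^sup>2 - s\<^sup>2
      - 2 * lam * ((w\<^sub>1 - w\<^sub>0) \<bullet> (x\<^sub>2 - u\<^sub>1)) - 2 * lam * (w \<bullet> (2 *\<^sub>R (x\<^sub>1 - z) - (x\<^sub>0 - z)))
      + 2 * b * ((x\<^sub>2 - u\<^sub>1) \<bullet> (u\<^sub>0 - x\<^sub>0)) - 2 * b * lam * ((w\<^sub>0 - w) \<bullet> (u\<^sub>0 - x\<^sub>0))
      - (norm (x\<^sub>2 - z))\<^sup>2
      = 2 * ((x\<^sub>1 - x\<^sub>0 + lam *\<^sub>R w\<^sub>0) \<bullet> (x\<^sub>2 - x\<^sub>1)) + 2 * ((x\<^sub>1 - x\<^sub>0 + lam *\<^sub>R w\<^sub>0) \<bullet> (x\<^sub>0 - x\<^sub>1))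
        + 2 * ((x\<^sub>2 - x\<^sub>1 + lam *\<^sub>R w\<^sub>1) \<bullet> (z - x\<^sub>2)) + 2 * (lam * ((w\<^sub>1 - w) \<bullet> (u\<^sub>1 - z)))
        + (b *\<^sub>R (u\<^sub>0 - x\<^sub>0)) \<bullet> (b *\<^sub>R (u\<^sub>0 - x\<^sub>0))"
      unfolding u1 d_def s_def power2_norm_eq_inner
      by (simp add: inner_simps inner_commute algebra_simps)
    then show ?thesis using P1 P2 P3 m bb by linarith
  qed
  have c1: "- (2 * lam * ((w\<^sub>1 - w\<^sub>0) \<bullet> (x\<^sub>2 - u\<^sub>1))) \<le> 2 * \<Lambda> * ((d + b * e + t) * s)"
  proof -
    \<comment> \<open>This splitting isolates \<open>x\<^sub>1 - u\<^sub>0\<close>, whose square is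
      already part of the previous potential.\<close>
    have "u\<^sub>1 - u\<^sub>0 = (x\<^sub>1 - x\<^sub>0) - b *\<^sub>R (u\<^sub>0 - x\<^sub>0) + (x\<^sub>1 - u\<^sub>0)" by (simp add: u1)
    then have "norm (u\<^sub>1 - u\<^sub>0) \<le> norm (x\<^sub>1 - x\<^sub>0) + norm (b *\<^sub>R (u\<^sub>0 - x\<^sub>0)) + norm (x\<^sub>1 - u\<^sub>0)"
      by (metis add_right_mono norm_triangle_ineq norm_triangle_ineq4 order_trans)
    then have "norm (u\<^sub>1 - u\<^sub>0) \<le> d + b * e + t" using b by (simp add: d_def e_def t_def)
    then have "lam * L * norm (u\<^sub>1 - u\<^sub>0) \<le> \<Lambda> * (d + b * e + t)"
      unfolding \<Lambda>(1)[symmetric] using \<Lambda>(2) by (rule mult_left_mono)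
    moreover have "lam * norm (w\<^sub>1 - w\<^sub>0) \<le> lam * L * norm (u\<^sub>1 - u\<^sub>0)"
      using lip1 lam by (simp add: mult.assoc)
    ultimately have "lam * norm (w\<^sub>1 - w\<^sub>0) * s \<le> \<Lambda> * (d + b * e + t) * s"
      using nonneg(2) by (intro mult_right_mono) auto
    moreover have "- ((w\<^sub>1 - w\<^sub>0) \<bullet> (x\<^sub>2 - u\<^sub>1)) \<le> norm (w\<^sub>1 - w\<^sub>0) * s"
      unfolding s_def using Cauchy_Schwarz_ineq2[of "w\<^sub>1 - w\<^sub>0" "x\<^sub>2 - u\<^sub>1"] by linarith
    then have "lam * - ((w\<^sub>1 - w\<^sub>0) \<bullet> (x\<^sub>2 - u\<^sub>1)) \<le> lam * (norm (w\<^sub>1 - w\<^sub>0) * s)"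
      using lam by (intro mult_left_mono) auto
    ultimately show ?thesis by (simp add: algebra_simps)
  qed
  have c2: "2 * b * ((x\<^sub>2 - u\<^sub>1) \<bullet> (u\<^sub>0 - x\<^sub>0)) \<le> b * (s\<^sup>2 + e\<^sup>2)"
  proof -
    have "2 * ((x\<^sub>2 - u\<^sub>1) \<bullet> (u\<^sub>0 - x\<^sub>0)) \<le> 2 * (s * e)"
      unfolding s_def e_def using norm_cauchy_schwarz by simp
    also have "\<dots> \<le> s\<^sup>2 + e\<^sup>2" using sum_squares_bound[of s e] by simp
    finally show ?thesis using mult_left_mono[OF _ b] by (metis mult.assoc mult.left_commute)
  qed
  have c3: "- (2 * b * lam * ((w\<^sub>0 - w) \<bullet> (u\<^sub>0 - x\<^sub>0))) \<le> b * (\<Lambda> * (D\<^sup>2 + 3 * e\<^sup>2))"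
  proof -
    \<comment> \<open>The detour through \<open>x\<^sub>0\<close> expresses the error in quantities
      that the Lyapunov function controls.\<close>
    have "norm (u\<^sub>0 - z) \<le> e + D"
      unfolding e_def D_def using norm_triangle_ineq[of "u\<^sub>0 - x\<^sub>0" "x\<^sub>0 - z"] by simp
    then have "\<Lambda> * norm (u\<^sub>0 - z) \<le> \<Lambda> * (e + D)" using \<Lambda>(2) by (rule mult_left_mono)
    moreover have "lam * norm (w\<^sub>0 - w) \<le> \<Lambda> * norm (u\<^sub>0 - z)"
      using lip0 lam by (simp add: \<Lambda>(1) mult.assoc)
    ultimately have "lam * norm (w\<^sub>0 - w) * e \<le> \<Lambda> * (e + D) * e"
      using nonneg(4) by (intro mult_right_mono) auto
    moreover have "- ((w\<^sub>0 - w) \<bullet> (u\<^sub>0 - x\<^sub>0)) \<le> norm (w\<^sub>0 - w) * e"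
      unfolding e_def using Cauchy_Schwarz_ineq2[of "w\<^sub>0 - w" "u\<^sub>0 - x\<^sub>0"] by linarith
    then have "lam * - ((w\<^sub>0 - w) \<bullet> (u\<^sub>0 - x\<^sub>0)) \<le> lam * (norm (w\<^sub>0 - w) * e)"
      using lam by (intro mult_left_mono) auto
    moreover have "\<Lambda> * (2 * (D * e)) \<le> \<Lambda> * (D\<^sup>2 + e\<^sup>2)"
      using sum_squares_bound[of D e] \<Lambda>(2) by (intro mult_left_mono) auto
    ultimately have "- (2 * (lam * ((w\<^sub>0 - w) \<bullet> (u\<^sub>0 - x\<^sub>0)))) \<le> \<Lambda> * (D\<^sup>2 + 3 * e\<^sup>2)"
      by (simp add: algebra_simps power2_eq_square)
    from mult_left_mono[OF this b] show ?thesis by (simp add: algebra_simps)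
  qed
  text \<open>Weighted AM-GM; the weight \<open>1 + sqrt 2\<close> makes the coefficients of \<open>d\<^sup>2\<close> and \<open>s\<^sup>2\<close> agree.\<close>
  have r2: "sqrt 2 * sqrt 2 = (2::real)" by simp
  have q: "2 * (d * s) \<le> (1 + sqrt 2) * d\<^sup>2 + (sqrt 2 - 1) * s\<^sup>2"
  proof -
    have "0 \<le> (sqrt 2 - 1) * ((1 + sqrt 2) * d - s)\<^sup>2" by simp
    also have "\<dots> = ((sqrt 2 - 1) * (1 + sqrt 2)) * ((1 + sqrt 2) * d\<^sup>2)
        - 2 * ((sqrt 2 - 1) * (1 + sqrt 2)) * (d * s) + (sqrt 2 - 1) * s\<^sup>2"
      by (simp add: algebra_simps power2_eq_square)
    also have "(sqrt 2 - 1) * (1 + sqrt 2) = 1" using r2 by (simp add: algebra_simps)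
    finally show ?thesis by simp
  qed
  have c4: "2 * \<Lambda> * ((d + b * e + t) * s)
      \<le> \<Lambda> * ((1 + sqrt 2) * d\<^sup>2 + (sqrt 2 - 1) * s\<^sup>2 + (t\<^sup>2 + s\<^sup>2)) + b * (\<Lambda> * (e\<^sup>2 + s\<^sup>2))"
  proof -
    have "2 * (t * s) \<le> t\<^sup>2 + s\<^sup>2" using sum_squares_bound[of t s] by simp
    moreover have "b * (2 * (e * s)) \<le> b * (e\<^sup>2 + s\<^sup>2)"
      using sum_squares_bound[of e s] b by (intro mult_left_mono) auto
    ultimately have "2 * ((d + b * e + t) * s)
      \<le> ((1 + sqrt 2) * d\<^sup>2 + (sqrt 2 - 1) * s\<^sup>2 + (t\<^sup>2 + s\<^sup>2)) + b * (e\<^sup>2 + s\<^sup>2)"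
      using q by (simp add: algebra_simps)
    from mult_left_mono[OF this \<Lambda>(2)] show ?thesis by (simp add: algebra_simps)
  qed
  \<comment> \<open>The constants 2, 5 and 1 are generous: \<Lambda> \<le> 1/2 already gives 3/2, 3
    and 1/2.\<close>
  have c5: "b * (s\<^sup>2 + e\<^sup>2) + b * (\<Lambda> * (D\<^sup>2 + 3 * e\<^sup>2)) + b * (\<Lambda> * (e\<^sup>2 + s\<^sup>2))
      \<le> b * (2 * s\<^sup>2 + 5 * e\<^sup>2 + D\<^sup>2)"
  proof -
    have "\<Lambda> * (D\<^sup>2 + 4 * e\<^sup>2 + s\<^sup>2) \<le> 1/2 * (D\<^sup>2 + 4 * e\<^sup>2 + s\<^sup>2)"
      using \<Lambda>(3) by (intro mult_right_mono) auto
    then have "\<Lambda> * D\<^sup>2 + 4 * (\<Lambda> * e\<^sup>2) + \<Lambda> * s\<^sup>2 \<le> D\<^sup>2 / 2 + 2 * e\<^sup>2 + s\<^sup>2 / 2"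
      by (simp add: algebra_simps)
    then have "(s\<^sup>2 + e\<^sup>2) + (\<Lambda> * (D\<^sup>2 + 3 * e\<^sup>2)) + (\<Lambda> * (e\<^sup>2 + s\<^sup>2)) \<le> 2 * s\<^sup>2 + 5 * e\<^sup>2 + D\<^sup>2"
      using zero_le_power2[of s] zero_le_power2[of e] zero_le_power2[of D]
      by (simp only: algebra_simps)
    from mult_left_mono[OF this b] show ?thesis by (simp only: distrib_left)
  qed
  have split: "w \<bullet> (2 *\<^sub>R (x\<^sub>1 - z) - (x\<^sub>0 - z)) = 2 * (w \<bullet> (x\<^sub>1 - z)) - w \<bullet> (x\<^sub>0 - z)"
    by (simp only: inner_diff_right inner_scaleR_right)
  have "(norm (x\<^sub>2 - z))\<^sup>2 \<le> (norm (x\<^sub>1 - z))\<^sup>2 - d\<^sup>2 - s\<^sup>2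
      - 2 * lam * (2 * (w \<bullet> (x\<^sub>1 - z)) - w \<bullet> (x\<^sub>0 - z))
      + \<Lambda> * ((1 + sqrt 2) * d\<^sup>2 + (sqrt 2 - 1) * s\<^sup>2 + (t\<^sup>2 + s\<^sup>2))
      + b * (2 * s\<^sup>2 + 5 * e\<^sup>2 + D\<^sup>2)"
    using energy[unfolded split] c1 c2 c3 c4 c5 by linarith
  \<comment> \<open>The old potential supplies \<open>\<Lambda> * t\<^sup>2\<close>. Moving the new
    potential \<open>\<Lambda> * s\<^sup>2\<close> to the left raises the coefficient of
    \<open>s\<^sup>2\<close> from sqrt 2 to 1 + sqrt 2 times \<Lambda>, so both squares keep the
    same slack \<kappa>.\<close>
  moreover have "\<Lambda> * ((1 + sqrt 2) * d\<^sup>2 + (sqrt 2 - 1) * s\<^sup>2 + (t\<^sup>2 + s\<^sup>2))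
      = d\<^sup>2 + s\<^sup>2 + \<Lambda> * t\<^sup>2 - \<Lambda> * s\<^sup>2 - \<kappa> * d\<^sup>2 - \<kappa> * s\<^sup>2"
    unfolding \<kappa> by (simp add: algebra_simps)
  moreover have "2 * lam * (2 * (w \<bullet> (x\<^sub>1 - z)) - w \<bullet> (x\<^sub>0 - z))
      = 2 * lam * (w \<bullet> (x\<^sub>1 - z)) + 2 * lam * (w \<bullet> (x\<^sub>1 - z)) - 2 * lam * (w \<bullet> (x\<^sub>0 - z))"
    by (simp add: algebra_simps)
  ultimately show ?thesis
    unfolding d_def[symmetric] s_def[symmetric] t_def[symmetric] e_def[symmetric] D_def[symmetric]
    by linarith
qed

text \<open>Deterministic Robbins--Siegmund: \<open>V n * exp (- (\<Sum>i<n. b i))\<close> is eventually decreasing.\<close>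

lemma almost_decreasing_convergent:
  fixes V \<tau> b :: "nat \<Rightarrow> real"
  assumes V: "\<And>n. 0 \<le> V n" and \<tau>: "\<And>n. 0 \<le> \<tau> n" and b: "\<And>n. 0 \<le> b n" "summable b"
    and step: "\<And>n. n \<ge> N \<Longrightarrow> V (Suc n) \<le> (1 + b n) * V n - \<tau> n"
  shows "convergent V" and "\<tau> \<longlonglongrightarrow> 0"
proof -
  define s where "s n = (\<Sum>i<n. b i)" for n
  define Q where "Q n = V n * exp (- s n)" for n
  have s_le: "s n \<le> suminf b" for n
    unfolding s_def using b by (intro sum_le_suminf) auto
  have lim_s: "s \<longlonglongrightarrow> suminf b"
    unfolding s_def using b(2) summable_LIMSEQ by blast
  have dec: "\<tau> n * exp (- suminf b - b n) \<le> Q n - Q (Suc n)" if "n \<ge> N" for n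
  proof -
    have "V (Suc n) + \<tau> n \<le> exp (b n) * V n"
      using step[OF that] mult_right_mono[OF exp_ge_add_one_self[of "b n"] V[of n]] by simp
    then have "(V (Suc n) + \<tau> n) * exp (- s (Suc n)) \<le> exp (b n) * V n * exp (- s (Suc n))"
      by (intro mult_right_mono) auto
    also have "\<dots> = Q n" by (simp add: Q_def s_def exp_minus exp_add exp_diff field_simps)
    finally have "Q (Suc n) + \<tau> n * exp (- s (Suc n)) \<le> Q n" by (simp add: Q_def distrib_right)
    moreover have "\<tau> n * exp (- suminf b - b n) \<le> \<tau> n * exp (- s (Suc n))"
      using s_le[of "Suc n"] b(1)[of n] \<tau>[of n] by (intro mult_left_mono) auto
    ultimately show ?thesis by simp
  qed
  have "decseq (\<lambda>n. Q (n + N))"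
  proof (rule decseq_SucI)
    fix n
    have "0 \<le> \<tau> (n + N) * exp (- suminf b - b (n + N))" using \<tau> by simp
    then show "Q (Suc n + N) \<le> Q (n + N)" using dec[of "n + N"] by simp
  qed
  moreover have "0 \<le> Q (n + N)" for n using V by (simp add: Q_def)
  ultimately obtain q where "(\<lambda>n. Q (n + N)) \<longlonglongrightarrow> q"
    using decseq_convergent[of "\<lambda>n. Q (n + N)" 0] by blast
  then have lim_Q: "Q \<longlonglongrightarrow> q" by (rule LIMSEQ_offset)
  have "(\<lambda>n. Q n * exp (s n)) \<longlonglongrightarrow> q * exp (suminf b)"
    by (intro tendsto_intros lim_Q lim_s)
  moreover have "Q n * exp (s n) = V n" for n by (simp add: Q_def exp_minus)
  ultimately show "convergent V" by (auto simp: convergent_def)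
  \<comment> \<open>Solving \<open>dec\<close> for \<open>\<tau> n\<close> bounds it by a vanishing
    difference of \<open>Q\<close> times a convergent factor.\<close>
  have "(\<lambda>n. (Q n - Q (Suc n)) * exp (suminf b + b n)) \<longlonglongrightarrow> (q - q) * exp (suminf b + 0)"
    by (intro tendsto_intros lim_Q LIMSEQ_Suc summable_LIMSEQ_zero b(2))
  moreover have "\<tau> n \<le> (Q n - Q (Suc n)) * exp (suminf b + b n)" if "n \<ge> N" for n
  proof -
    have "\<tau> n * exp (- suminf b - b n) * exp (suminf b + b n)
        \<le> (Q n - Q (Suc n)) * exp (suminf b + b n)"
      using dec[OF that] by (intro mult_right_mono) auto
    then show ?thesis by (simp add: mult.assoc flip: exp_add)
  qed
  then have "eventually (\<lambda>n. \<tau> n \<le> (Q n - Q (Suc n)) * exp (suminf b + b n)) sequentially"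
    unfolding eventually_sequentially by blast
  ultimately show "\<tau> \<longlonglongrightarrow> 0"
    by (intro tendsto_sandwich[OF _ _ tendsto_const, of 0 \<tau>]) (auto simp: \<tau>)
qed

section \<open>The certificate\<close>

text \<open>The \<Lambda>-free factor of \<open>muB\<close>, split off so that the certificate
  depends on the filter only through one number, the sum of its squares.\<close>

definition filter_conv :: "(nat \<Rightarrow> real) \<Rightarrow> nat \<Rightarrow> real" where
  "filter_conv \<beta> j = (\<Sum>k. filter_sup \<beta> ^ k * \<beta> (j + 1 + k))"

lemma muB_eq: "muB \<beta> \<Lambda> j = 2 * \<Lambda> * filter_conv \<beta> j"
  by (simp add: muB_def filter_conv_def)

lemma admissible_filter_sup:
  assumes "admissible_filter \<beta>"
  shows "\<beta> n \<le> filter_sup \<beta>" "0 \<le> filter_sup \<beta>" "filter_sup \<beta> \<le> 1/4"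
proof -
  have "bdd_above (range \<beta>)"
    using assms by (auto simp: admissible_filter_def intro!: bdd_aboveI[of _ "1/4"])
  then show *: "\<beta> n \<le> filter_sup \<beta>" for n
    unfolding filter_sup_def by (intro cSUP_upper) auto
  show "0 \<le> filter_sup \<beta>"
    using *[of 0] assms order_trans by (auto simp: admissible_filter_def)
  show "filter_sup \<beta> \<le> 1/4"
    unfolding filter_sup_def using assms by (intro cSUP_least) (auto simp: admissible_filter_def)
qed

lemma summable_filter_conv_terms:
  assumes "admissible_filter \<beta>"
  shows "summable (\<lambda>k. filter_sup \<beta> ^ k * \<beta> (j + 1 + k))"
proof (rule summable_comparison_test')
  show "summable (\<lambda>k. \<beta> (k + (j + 1)))"
    using assms by (intro summable_ignore_initial_segment) (simp add: admissible_filter_def)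
  show "norm (filter_sup \<beta> ^ k * \<beta> (j + 1 + k)) \<le> \<beta> (k + (j + 1))" for k
  proof -
    have "0 \<le> \<beta> (j + 1 + k)" using assms by (simp add: admissible_filter_def)
    moreover have "0 \<le> filter_sup \<beta> ^ k" "filter_sup \<beta> ^ k \<le> 1"
      using admissible_filter_sup[OF assms] by (auto intro: power_le_one)
    ultimately show ?thesis
      by (simp add: abs_mult mult_left_le_one_le add.commute add.left_commute)
  qed
qed

lemma filter_conv_nonneg:
  assumes "admissible_filter \<beta>"
  shows "0 \<le> filter_conv \<beta> j"
  unfolding filter_conv_def
  using summable_filter_conv_terms[OF assms] admissible_filter_sup[OF assms] assms
  by (intro suminf_nonneg) (auto simp: admissible_filter_def)

text \<open>The weights form a geometric series of ratio at most 1/4, hence of sum at most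
  4/3.\<close>

lemma filter_conv_le_bound:
  assumes "admissible_filter \<beta>" and c: "\<And>k. \<beta> (j + 1 + k) \<le> c"
  shows "filter_conv \<beta> j \<le> 4/3 * c"
proof -
  define s where "s = filter_sup \<beta>"
  have s: "0 \<le> s" "s \<le> 1/4" unfolding s_def using admissible_filter_sup[OF assms(1)] by auto
  have "0 \<le> c" using c[of 0] assms(1) by (auto simp: admissible_filter_def intro: order_trans)
  have "(\<lambda>k. s ^ k * c) sums (1 / (1 - s) * c)"
    using s by (intro sums_mult2 geometric_sums) auto
  moreover have "filter_conv \<beta> j \<le> (\<Sum>k. s ^ k * c)"
    unfolding filter_conv_def s_def[symmetric]
  proof (rule suminf_le)
    show "s ^ k * \<beta> (j + 1 + k) \<le> s ^ k * c" for k
      using s c by (intro mult_left_mono) auto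
    show "summable (\<lambda>k. s ^ k * \<beta> (j + 1 + k))"
      unfolding s_def by (rule summable_filter_conv_terms[OF assms(1)])
    show "summable (\<lambda>k. s ^ k * c)" using calculation by (rule sums_summable)
  qed
  ultimately have "filter_conv \<beta> j \<le> 1 / (1 - s) * c" by (simp add: sums_iff)
  also have "\<dots> \<le> 4/3 * c"
    using s \<open>0 \<le> c\<close> by (intro mult_right_mono) (auto simp: field_simps)
  finally show ?thesis .
qed

text \<open>Young's inequality for a convolution in l^1: after exchanging the sums, each shifted
  partial sum of \<beta> is a subsum of the whole series, and the geometric weights contribute
  4/3.\<close>

lemma sum_filter_conv_le:
  assumes "admissible_filter \<beta>"
  shows "(\<Sum>j<n. filter_conv \<beta> j) \<le> 4/3 * suminf \<beta>"
proof -
  define s where "s = filter_sup \<beta>"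
  have s: "0 \<le> s" "s \<le> 1/4" unfolding s_def using admissible_filter_sup[OF assms(1)] by auto
  have \<beta>: "0 \<le> \<beta> k" "summable \<beta>" for k using assms by (auto simp: admissible_filter_def)
  have "0 \<le> suminf \<beta>" using \<beta> by (intro suminf_nonneg) auto
  have geo: "(\<lambda>k. s ^ k * suminf \<beta>) sums (1 / (1 - s) * suminf \<beta>)"
    using s by (intro sums_mult2 geometric_sums) auto
  have sm: "summable (\<lambda>k. s ^ k * \<beta> (j + 1 + k))" for j
    unfolding s_def by (rule summable_filter_conv_terms[OF assms(1)])
  have "(\<Sum>j<n. filter_conv \<beta> j) = (\<Sum>k. \<Sum>j<n. s ^ k * \<beta> (j + 1 + k))"
    unfolding filter_conv_def s_def[symmetric] using sm by (intro suminf_sum[symmetric]) 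
  also have "\<dots> \<le> (\<Sum>k. s ^ k * suminf \<beta>)"
  proof (rule suminf_le)
    fix k
    have "(\<Sum>j<n. \<beta> (j + 1 + k)) = sum \<beta> ((\<lambda>j. j + 1 + k) ` {..<n})"
      by (simp add: sum.reindex inj_on_def)
    also have "\<dots> \<le> suminf \<beta>" using \<beta> by (intro sum_le_suminf) auto
    finally show "(\<Sum>j<n. s ^ k * \<beta> (j + 1 + k)) \<le> s ^ k * suminf \<beta>"
      using s by (simp add: mult_left_mono flip: sum_distrib_left)
    show "summable (\<lambda>k. \<Sum>j<n. s ^ k * \<beta> (j + 1 + k))" using sm by (intro summable_sum)
    show "summable (\<lambda>k. s ^ k * suminf \<beta>)" using geo by (rule sums_summable)
  qed
  also have "\<dots> = 1 / (1 - s) * suminf \<beta>" using geo by (simp add: sums_iff)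
  also have "\<dots> \<le> 4/3 * suminf \<beta>"
    using s \<open>0 \<le> suminf \<beta>\<close> by (intro mult_right_mono) (auto simp: field_simps)
  finally show ?thesis .
qed

text \<open>A sum of squares is at most the supremum times the sum; each of the two preceding bounds
  contributes a factor 4/3.\<close>

lemma filter_conv_squares:
  assumes "admissible_filter \<beta>"
  shows summable_filter_conv_squares: "summable (\<lambda>j. (filter_conv \<beta> j)\<^sup>2)"
    and suminf_filter_conv_squares_le:
      "(\<Sum>j. (filter_conv \<beta> j)\<^sup>2) \<le> 16/9 * filter_sup \<beta> * suminf \<beta>"
proof -
  note w = filter_conv_nonneg[OF assms]
  have part: "(\<Sum>j<n. (filter_conv \<beta> j)\<^sup>2) \<le> 16/9 * filter_sup \<beta> * suminf \<beta>" for n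
  proof -
    have "(\<Sum>j<n. (filter_conv \<beta> j)\<^sup>2) \<le> (\<Sum>j<n. 4/3 * filter_sup \<beta> * filter_conv \<beta> j)"
      unfolding power2_eq_square using admissible_filter_sup(1)[OF assms] w
      by (intro sum_mono mult_right_mono filter_conv_le_bound[OF assms]) auto
    also have "\<dots> = 4/3 * filter_sup \<beta> * (\<Sum>j<n. filter_conv \<beta> j)" by (simp add: sum_distrib_left)
    also have "\<dots> \<le> 4/3 * filter_sup \<beta> * (4/3 * suminf \<beta>)"
      using admissible_filter_sup[OF assms] sum_filter_conv_le[OF assms]
      by (intro mult_left_mono) auto
    finally show ?thesis by simp
  qed
  show "summable (\<lambda>j. (filter_conv \<beta> j)\<^sup>2)"
    by (rule summableI_nonneg_bounded[OF _ part]) simp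
  then show "(\<Sum>j. (filter_conv \<beta> j)\<^sup>2) \<le> 16/9 * filter_sup \<beta> * suminf \<beta>"
    using part by (intro suminf_le_const)
qed

lemma certificate_iff:
  assumes "admissible_filter \<beta>"
  shows "certificate \<beta> \<Lambda> \<longleftrightarrow> \<Lambda> < sqrt 2 - 1 \<and>
    4 * \<Lambda>\<^sup>2 * (\<Sum>j. (filter_conv \<beta> j)\<^sup>2) \<le> (1 - (1 + sqrt 2) * \<Lambda>)\<^sup>2"
proof -
  have "(\<Sum>j. (muB \<beta> \<Lambda> j)\<^sup>2) = (\<Sum>j. 4 * \<Lambda>\<^sup>2 * (filter_conv \<beta> j)\<^sup>2)"
    by (simp add: muB_eq power_mult_distrib)
  also have "\<dots> = 4 * \<Lambda>\<^sup>2 * (\<Sum>j. (filter_conv \<beta> j)\<^sup>2)"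
    by (intro suminf_mult summable_filter_conv_squares assms)
  finally show ?thesis by (simp add: certificate_def)
qed

lemma less_sqrt2_minus_1_iff: "\<Lambda> < sqrt 2 - 1 \<longleftrightarrow> (1 + sqrt 2) * \<Lambda> < 1"
proof -
  have "(1 + sqrt 2) * (sqrt 2 - 1) = (1::real)" by (simp add: algebra_simps)
  then have "(1 + sqrt 2) * \<Lambda> < 1 \<longleftrightarrow> (1 + sqrt 2) * \<Lambda> < (1 + sqrt 2) * (sqrt 2 - 1)" by simp
  also have "\<dots> \<longleftrightarrow> \<Lambda> < sqrt 2 - 1" by (intro mult_less_cancel_left_pos) (simp add: add_pos_pos)
  finally show ?thesis by simp
qed

text \<open>Below sqrt 2 - 1 both squared quantities have nonnegative bases, so the certificate is
  linear in \<Lambda>. Positivity of the sum makes the strict bound follow from the linear one; with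
  sum zero the endpoint would be sqrt 2 - 1 itself, which is excluded.\<close>

lemma certificate_iff_le:
  assumes "admissible_filter \<beta>" "0 \<le> \<Lambda>" "0 < (\<Sum>j. (filter_conv \<beta> j)\<^sup>2)"
  shows "certificate \<beta> \<Lambda> \<longleftrightarrow> \<Lambda> \<le> 1 / (1 + sqrt 2 + 2 * sqrt (\<Sum>j. (filter_conv \<beta> j)\<^sup>2))"
proof -
  define r where "r = sqrt (\<Sum>j. (filter_conv \<beta> j)\<^sup>2)"
  have r: "0 < r" using assms(3) by (simp add: r_def)
  have "4 * \<Lambda>\<^sup>2 * (\<Sum>j. (filter_conv \<beta> j)\<^sup>2) = (2 * \<Lambda> * r)\<^sup>2"
    using assms(3) by (simp add: r_def power_mult_distrib)
  then have "certificate \<beta> \<Lambda> \<longleftrightarrow>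
      (1 + sqrt 2) * \<Lambda> < 1 \<and> (2 * \<Lambda> * r)\<^sup>2 \<le> (1 - (1 + sqrt 2) * \<Lambda>)\<^sup>2"
    using certificate_iff[OF assms(1)] less_sqrt2_minus_1_iff by simp
  also have "\<dots> \<longleftrightarrow> (1 + sqrt 2) * \<Lambda> < 1 \<and> 2 * \<Lambda> * r \<le> 1 - (1 + sqrt 2) * \<Lambda>"
    using assms(2) r by (auto simp: power2_le_iff_abs_le abs_if)
  also have "\<dots> \<longleftrightarrow> (1 + sqrt 2 + 2 * r) * \<Lambda> \<le> 1"
  proof -
    have "(1 + sqrt 2) * \<Lambda> < 1" if h: "(1 + sqrt 2 + 2 * r) * \<Lambda> \<le> 1"
    proof (cases "\<Lambda> = 0")
      case False
      then have "0 < 2 * r * \<Lambda>" using assms(2) r by simp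
      then show ?thesis using h by (simp only: distrib_right)
    qed simp
    then show ?thesis by (auto simp: algebra_simps)
  qed
  also have "\<dots> \<longleftrightarrow> \<Lambda> \<le> 1 / (1 + sqrt 2 + 2 * r)"
  proof -
    have "0 < 1 + sqrt 2 + 2 * r" using r by (simp add: add_pos_pos)
    then show ?thesis by (simp add: pos_le_divide_eq mult.commute)
  qed
  finally show ?thesis by (simp add: r_def)
qed

section \<open>The certified range for small filters\<close>

text \<open>Staying \<epsilon> below the limit step leaves a fixed slack \<kappa>, while for sums
  bounded by \<open>K\<close> the left side of the certificate is of the order of
  \<open>filter_sup b\<close>.\<close>

lemma certified_range_bounds:
  fixes M K \<epsilon> :: real
  assumes "M > 0" "\<epsilon> > 0"
  obtains \<delta> where "\<delta> > 0"
    "\<And>b. admissible_filter b \<Longrightarrow> suminf b \<le> K \<Longrightarrow> filter_sup b < \<delta> \<Longrightarrow>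
       {0<..(sqrt 2 - 1) / M - \<epsilon>} \<subseteq> certified_range b M"
proof -
  \<comment> \<open>The value of \<open>1 - (1 + sqrt 2) * (lam * M)\<close> at the endpoint
    \<open>lam = (sqrt 2 - 1) / M - \<epsilon>\<close>.\<close>
  define \<kappa> where "\<kappa> = (1 + sqrt 2) * (\<epsilon> * M)"
  have \<kappa>: "0 < \<kappa>" unfolding \<kappa>_def using assms by (simp add: add_pos_pos)
  \<comment> \<open>Chosen so that \<open>16/9 * \<delta> * (\<bar>K\<bar> + 1)\<close> is at most
    \<open>\<kappa>\<^sup>2\<close>; the absolute value keeps the denominator positive for every
    \<open>K\<close>.\<close>
  define \<delta> where "\<delta> = \<kappa>\<^sup>2 / (8 * (\<bar>K\<bar> + 1))"
  have "0 < \<delta>" unfolding \<delta>_def using \<kappa> by (intro divide_pos_pos) auto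
  moreover have "certificate b (lam * M)"
    if b: "admissible_filter b" "suminf b \<le> K" "filter_sup b < \<delta>"
      and lam: "0 < lam" "lam \<le> (sqrt 2 - 1) / M - \<epsilon>" for b lam
  proof -
    define \<Lambda> where "\<Lambda> = lam * M"
    have "lam + \<epsilon> \<le> (sqrt 2 - 1) / M" using lam(2) by simp
    then have "(lam + \<epsilon>) * M \<le> sqrt 2 - 1" by (rule pos_le_divide_eq[THEN iffD1, OF assms(1)])
    then have le: "\<Lambda> \<le> (sqrt 2 - 1) - \<epsilon> * M" by (simp add: \<Lambda>_def distrib_right)
    have pos: "0 < \<Lambda>" "0 < \<epsilon> * M" using assms lam(1) by (simp_all add: \<Lambda>_def)
    have less: "\<Lambda> < sqrt 2 - 1" using le pos by simp
    have "(1 + sqrt 2) * \<Lambda> \<le> (1 + sqrt 2) * ((sqrt 2 - 1) - \<epsilon> * M)"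
      using le by (intro mult_left_mono) auto
    also have "\<dots> = 1 - \<kappa>" unfolding \<kappa>_def by (simp add: algebra_simps)
    finally have k: "\<kappa> \<le> 1 - (1 + sqrt 2) * \<Lambda>" by simp
    have "sqrt 2 \<le> 3/2" by (rule real_le_lsqrt) (auto simp: power2_eq_square)
    then have "\<Lambda> \<le> 1/2" using less by simp
    then have "\<Lambda>\<^sup>2 \<le> (1/2)\<^sup>2" using pos by (intro power_mono) auto
    then have L2: "4 * \<Lambda>\<^sup>2 \<le> 1" by (simp add: power2_eq_square)
    have sup: "0 \<le> filter_sup b" using admissible_filter_sup[OF b(1)] by simp
    have "0 \<le> suminf b" using b(1) by (intro suminf_nonneg) (auto simp: admissible_filter_def)
    have W0: "0 \<le> (\<Sum>j. (filter_conv b j)\<^sup>2)"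
      by (intro suminf_nonneg summable_filter_conv_squares b(1)) auto
    have "(\<Sum>j. (filter_conv b j)\<^sup>2) \<le> 16/9 * filter_sup b * suminf b"
      by (rule suminf_filter_conv_squares_le[OF b(1)])
    also have "\<dots> \<le> 16/9 * \<delta> * (\<bar>K\<bar> + 1)"
      using b(2,3) sup \<open>0 \<le> suminf b\<close> by (intro mult_mono) auto
    also have "\<dots> \<le> \<kappa>\<^sup>2" by (simp add: \<delta>_def field_simps)
    also have "\<dots> \<le> (1 - (1 + sqrt 2) * \<Lambda>)\<^sup>2" using k \<kappa> by (intro power_mono) auto
    finally have "(\<Sum>j. (filter_conv b j)\<^sup>2) \<le> (1 - (1 + sqrt 2) * \<Lambda>)\<^sup>2" .
    moreover have "4 * \<Lambda>\<^sup>2 * (\<Sum>j. (filter_conv b j)\<^sup>2) \<le> (\<Sum>j. (filter_conv b j)\<^sup>2)"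
      using mult_right_mono[OF L2 W0] by simp
    ultimately show ?thesis using less certificate_iff[OF b(1)] by (simp add: \<Lambda>_def)
  qed
  ultimately show ?thesis using that by (force simp: certified_range_def)
qed

lemma certified_range_subset:
  assumes "M > 0"
  shows "certified_range b M \<subseteq> {0<..<(sqrt 2 - 1) / M}"
  using assms by (auto simp: certified_range_def certificate_def pos_less_divide_eq)

section \<open>Numerical enclosure for the quadratic filter\<close>

text \<open>Integral comparison in telescoping form: 1 / (9 (m+1)^4) is at most the integral of 1 /
  (9 t^4) from m to m+1, which is a difference of inverse cubes over 27.\<close>

lemma suminf_squares_tail_le:
  fixes f :: "nat \<Rightarrow> real"
  assumes f: "\<And>j. f j \<le> 1 / (3 * real (j + 2) ^ 2)" "\<And>j. 0 \<le> f j" "summable (\<lambda>j. (f j)\<^sup>2)"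
  shows "(\<Sum>j. (f (j + N))\<^sup>2) \<le> 1 / (27 * real (N + 1) ^ 3)"
proof (rule suminf_le_const)
  show "summable (\<lambda>j. (f (j + N))\<^sup>2)" using f(3) by (rule summable_ignore_initial_segment)
  have telescope: "1 / 9 / (m + 1) ^ 4 \<le> 1 / 27 * (1 / m ^ 3 - 1 / (m + 1) ^ 3)" if "m > 0" for m :: real
  proof -
    have "1 / 27 * (1 / m ^ 3 - 1 / (m + 1) ^ 3) - 1 / 9 / (m + 1) ^ 4
        = (6 * m\<^sup>2 + 4 * m + 1) / (27 * m ^ 3 * (m + 1) ^ 4)"
      using that by (simp add: divide_simps) (simp add: algebra_simps eval_nat_numeral)
    also have "\<dots> \<ge> 0" using that by simp
    finally show ?thesis by simp
  qed
  have step: "(f (j + N))\<^sup>2 \<le> 1 / 27 * (1 / real (j + N + 1) ^ 3 - 1 / real (Suc j + N + 1) ^ 3)" for j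
  proof -
    have "(f (j + N))\<^sup>2 \<le> (1 / (3 * real (j + N + 2) ^ 2))\<^sup>2"
      using f(1)[of "j + N"] f(2) by (intro power_mono) auto
    also have "\<dots> = 1 / 9 / (real (j + N + 1) + 1) ^ 4" by (simp add: power_divide power_mult_distrib flip: power_mult)
    also have "\<dots> \<le> 1 / 27 * (1 / real (j + N + 1) ^ 3 - 1 / (real (j + N + 1) + 1) ^ 3)"
      by (rule telescope) simp
    finally show ?thesis by (simp add: add.commute add.left_commute)
  qed
  show "(\<Sum>j<n. (f (j + N))\<^sup>2) \<le> 1 / (27 * real (N + 1) ^ 3)" for n
  proof -
    have "(\<Sum>j<n. (f (j + N))\<^sup>2) \<le> (\<Sum>j<n. 1 / 27 * (1 / real (j + N + 1) ^ 3 - 1 / real (Suc j + N + 1) ^ 3))"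
      by (intro sum_mono step)
    also have "\<dots> = 1 / 27 * (1 / real (0 + N + 1) ^ 3 - 1 / real (n + N + 1) ^ 3)"
      unfolding sum_distrib_left[symmetric] by (subst sum_lessThan_telescope') simp
    also have "\<dots> \<le> 1 / (27 * real (N + 1) ^ 3)" by simp
    finally show ?thesis .
  qed
qed

lemma admissible_quadratic_filter: "admissible_filter quadratic_filter"
proof -
  have "summable (\<lambda>n. 1/4 * inverse (real (Suc n) ^ 2))"
    by (intro summable_mult summable_Suc_iff[THEN iffD2] inverse_power_summable) auto
  then have "summable quadratic_filter"
    by (simp add: quadratic_filter_def[abs_def] field_simps)
  moreover have "quadratic_filter n \<le> 1/4" for n
  proof -
    have "1 \<le> (real n + 1)\<^sup>2" by (intro one_le_power) simp
    then show ?thesis by (simp add: quadratic_filter_def divide_simps)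
  qed
  ultimately show ?thesis by (simp add: admissible_filter_def quadratic_filter_def)
qed

lemma filter_sup_quadratic_filter: "filter_sup quadratic_filter = 1/4"
proof (rule antisym)
  show "filter_sup quadratic_filter \<le> 1/4"
    by (rule admissible_filter_sup[OF admissible_quadratic_filter])
  show "1/4 \<le> filter_sup quadratic_filter"
    using admissible_filter_sup(1)[OF admissible_quadratic_filter, of 0]
    by (simp add: quadratic_filter_def)
qed

lemma quadratic_filter_antimono: "m \<le> n \<Longrightarrow> quadratic_filter n \<le> quadratic_filter m"
  unfolding quadratic_filter_def by (intro divide_left_mono power_mono) auto

text \<open>Four terms are kept exactly. As the filter decreases, the rest is at most a geometric
  tail, and 192 comes from (1/4)^4 * 4/3 = 1/192.\<close>

lemma quadratic_filter_conv_split: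
  obtains r where "filter_conv quadratic_filter j = quadratic_filter (j + 1)
    + quadratic_filter (j + 2) / 4 + quadratic_filter (j + 3) / 16 + quadratic_filter (j + 4) / 64 + r"
    "0 \<le> r" "r \<le> quadratic_filter (j + 5) / 192"
proof -
  define t where "t k = (1/4) ^ k * quadratic_filter (j + 1 + k)" for k
  have t_nonneg: "0 \<le> t k" for k by (simp add: t_def quadratic_filter_def)
  have sm: "summable t"
    using summable_filter_conv_terms[OF admissible_quadratic_filter, of j]
    by (simp add: t_def[abs_def] filter_sup_quadratic_filter)
  have eq: "filter_conv quadratic_filter j = (\<Sum>k. t (k + 4)) + (\<Sum>k<4. t k)"
    unfolding filter_conv_def filter_sup_quadratic_filter t_def[symmetric]
    by (rule suminf_split_initial_segment[OF sm])
  have "(\<lambda>k. (1/4::real) ^ k * (1/256 * quadratic_filter (j + 5))) sums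
      (1 / (1 - 1/4) * (1/256 * quadratic_filter (j + 5)))"
    by (intro sums_mult2 geometric_sums) auto
  then have geo: "(\<lambda>k. (1/4::real) ^ k * (1/256 * quadratic_filter (j + 5))) sums (quadratic_filter (j + 5) / 192)"
    by simp
  have "(\<Sum>k. t (k + 4)) \<le> (\<Sum>k. (1/4::real) ^ k * (1/256 * quadratic_filter (j + 5)))"
  proof (rule suminf_le)
    show "t (k + 4) \<le> (1/4::real) ^ k * (1/256 * quadratic_filter (j + 5))" for k
      using quadratic_filter_antimono[of "j + 5" "j + 1 + (k + 4)"]
      by (simp add: t_def power_add power_divide divide_simps)
    show "summable (\<lambda>k. t (k + 4))" using sm by (rule summable_ignore_initial_segment)
  qed (rule sums_summable[OF geo])
  then have "(\<Sum>k. t (k + 4)) \<le> quadratic_filter (j + 5) / 192"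
    using geo by (simp add: sums_iff)
  moreover have "0 \<le> (\<Sum>k. t (k + 4))"
    using sm t_nonneg by (intro suminf_nonneg summable_ignore_initial_segment)
  moreover have "(\<Sum>k<4. t k) = quadratic_filter (j + 1) + quadratic_filter (j + 2) / 4
      + quadratic_filter (j + 3) / 16 + quadratic_filter (j + 4) / 64"
    by (simp add: t_def numeral_eq_Suc)
  ultimately show ?thesis using that[of "\<Sum>k. t (k + 4)"] eq by simp
qed

lemma quadratic_filter_conv_square_sum:
  shows "0.00669 \<le> (\<Sum>j. (filter_conv quadratic_filter j)\<^sup>2)"
    and "(\<Sum>j. (filter_conv quadratic_filter j)\<^sup>2) \<le> 0.00673"
proof -
  define w where "w = filter_conv quadratic_filter"
  define a where "a j = quadratic_filter (j + 1) + quadratic_filter (j + 2) / 4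
    + quadratic_filter (j + 3) / 16 + quadratic_filter (j + 4) / 64" for j
  define c where "c j = a j + quadratic_filter (j + 5) / 192" for j
  have a_nonneg: "0 \<le> a j" for j by (simp add: a_def quadratic_filter_def)
  have w: "a j \<le> w j" "w j \<le> c j" for j
    using quadratic_filter_conv_split[of j] unfolding w_def a_def c_def by force+
  have sm: "summable (\<lambda>j. (w j)\<^sup>2)"
    unfolding w_def by (rule summable_filter_conv_squares[OF admissible_quadratic_filter])
  \<comment> \<open>With eleven explicit terms the tail is at most 1 / (27 * 12^3), about 0.0000214,
    which fits into the width 0.00004 of the enclosure.\<close>
  have split: "(\<Sum>j. (w j)\<^sup>2) = (\<Sum>j. (w (j + 11))\<^sup>2) + (\<Sum>j<11. (w j)\<^sup>2)"
    by (rule suminf_split_initial_segment[OF sm])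
  have w_le: "w j \<le> 1 / (3 * real (j + 2) ^ 2)" for j
  proof -
    have "w j \<le> 4/3 * quadratic_filter (j + 1)"
      unfolding w_def by (rule filter_conv_le_bound[OF admissible_quadratic_filter])
        (rule quadratic_filter_antimono, simp)
    then show ?thesis by (simp add: quadratic_filter_def add.commute)
  qed
  have w_nonneg: "0 \<le> w j" for j using a_nonneg w(1) order_trans by blast
  have tail: "(\<Sum>j. (w (j + 11))\<^sup>2) \<le> 1 / (27 * real (11 + 1) ^ 3)"
    using w_le w_nonneg sm by (rule suminf_squares_tail_le)
  have tail_nonneg: "0 \<le> (\<Sum>j. (w (j + 11))\<^sup>2)"
    using sm by (intro suminf_nonneg summable_ignore_initial_segment) auto
  have "0.00669 \<le> (\<Sum>j<11. (a j)\<^sup>2)"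
    by (simp add: a_def quadratic_filter_def numeral_eq_Suc power2_eq_square)
  also have "\<dots> \<le> (\<Sum>j<11. (w j)\<^sup>2)" using w a_nonneg by (intro sum_mono power_mono) auto
  finally show "0.00669 \<le> (\<Sum>j. (filter_conv quadratic_filter j)\<^sup>2)"
    using split tail_nonneg by (simp add: w_def)
  have "(\<Sum>j<11. (w j)\<^sup>2) \<le> (\<Sum>j<11. (c j)\<^sup>2)" using w w_nonneg by (intro sum_mono power_mono) auto
  moreover have "(\<Sum>j<11. (c j)\<^sup>2) + 1 / (27 * real (11 + 1) ^ 3) \<le> 0.00673"
    by (simp add: c_def a_def quadratic_filter_def numeral_eq_Suc power2_eq_square)
  ultimately show "(\<Sum>j. (filter_conv quadratic_filter j)\<^sup>2) \<le> 0.00673"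
    using split tail by (simp add: w_def)
qed

text \<open>The cutoff 1 / (1 + sqrt 2 + 2 sqrt W) decreases in both roots, so rational brackets for
  them, checked by squaring, enclose it to four digits.\<close>

lemma quadratic_filter_cutoff:
  obtains c where "0.387 \<le> c" "\<bar>c - 0.3879\<bar> \<le> 0.00005"
    "\<And>\<Lambda>. 0 \<le> \<Lambda> \<Longrightarrow> certificate quadratic_filter \<Lambda> \<longleftrightarrow> \<Lambda> \<le> c"
proof -
  define W where "W = (\<Sum>j. (filter_conv quadratic_filter j)\<^sup>2)"
  define r where "r = sqrt W"
  define c where "c = 1 / (1 + sqrt 2 + 2 * r)"
  note W = quadratic_filter_conv_square_sum[folded W_def]
  have r: "0.08179 \<le> r" "r \<le> 0.082037"
    unfolding r_def using W
    by (intro real_le_rsqrt real_le_lsqrt; simp add: power2_eq_square)+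
  have s2: "1.4142135 \<le> sqrt 2" "sqrt 2 \<le> 1.4142136"
    by (intro real_le_rsqrt real_le_lsqrt; simp add: power2_eq_square)+
  have c: "0.38785 \<le> c" "c \<le> 0.38795"
    unfolding c_def using r s2 by (simp_all add: field_simps)
  have "certificate quadratic_filter \<Lambda> \<longleftrightarrow> \<Lambda> \<le> c" if "0 \<le> \<Lambda>" for \<Lambda>
    unfolding c_def r_def W_def using quadratic_filter_conv_square_sum(1)
    by (intro certificate_iff_le admissible_quadratic_filter that) simp
  moreover have "0.387 \<le> c" using c by simp
  moreover have "\<bar>c - 0.3879\<bar> \<le> 0.00005" using c by (intro abs_leI; simp)
  ultimately show ?thesis using that by blast
qed

section \<open>Convergence of the filtered iteration\<close>

text \<open>The slack \<kappa> of the one-step estimate pays for the memory term \<open>e\<close>,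
  which contracts up to a multiple of \<open>d\<close>, and for the filter errors once \<beta> is
  small. Only the error in \<open>D\<close> remains, and it becomes a summable growth
  factor.\<close>

lemma filtered_iteration_fejer:
  fixes C :: "'a::{real_inner, complete_space} set"
  assumes C: "C \<noteq> {}" "closed C" "convex C" and B: "monotone_operator B" "L-lipschitz_on UNIV B"
    and \<beta>: "admissible_filter \<beta>" and lam: "lam > 0" and \<Lambda>: "lam * L < sqrt 2 - 1"
    and it: "filtered_iteration C B lam \<beta> x u" and z: "z \<in> VI_solutions C B"
  shows "convergent (\<lambda>n. (norm (x n - z))\<^sup>2)"
    and "(\<lambda>n. norm (x (Suc n) - x n)) \<longlonglongrightarrow> 0"
    and "(\<lambda>n. norm (u n - x n)) \<longlonglongrightarrow> 0"
proof -
  define \<Lambda> where "\<Lambda> = lam * L"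
  define \<kappa> where "\<kappa> = 1 - (1 + sqrt 2) * \<Lambda>"
  define D where "D n = (norm (x n - z))\<^sup>2" for n
  define d where "d n = (norm (x (Suc n) - x n))\<^sup>2" for n
  define s where "s n = (norm (x (Suc n) - u n))\<^sup>2" for n
  define e where "e n = (norm (u n - x n))\<^sup>2" for n
  define a where "a n = 2 * lam * (B z \<bullet> (x n - z))" for n
  \<comment> \<open>The index of \<open>D\<close> is shifted because \<open>s n\<close> measures
    \<open>x (Suc n)\<close> against \<open>u n\<close>; the weighted \<open>e n\<close> carries the
    memory of the filter.\<close>
  define V where "V n = D (Suc n) + \<Lambda> * s n + a n + \<kappa> / 4 * e n" for n
  \<comment> \<open>The decrease left after absorbing errors. It contains \<open>a (Suc n)\<close>
    because the one-step estimate provides this term once for the new potential and once as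
    surplus.\<close>
  define \<tau> where "\<tau> n = \<kappa> / 4 * d n + \<kappa> / 8 * e n + a (Suc n)" for n
  have L: "0 \<le> L" using B(2) by (rule lipschitz_on_nonneg)
  have \<beta>': "0 \<le> \<beta> n" "\<beta> n \<le> 1/4" "summable \<beta>" for n
    using \<beta> by (auto simp: admissible_filter_def)
  have \<Lambda>': "0 \<le> \<Lambda>" "\<Lambda> \<le> 1/2" "0 < \<kappa>"
  proof -
    show "0 \<le> \<Lambda>" using L lam by (simp add: \<Lambda>_def)
    have "sqrt 2 \<le> 3/2" by (rule real_le_lsqrt) (auto simp: power2_eq_square)
    then show "\<Lambda> \<le> 1/2" using \<Lambda> by (simp add: \<Lambda>_def)
    show "0 < \<kappa>" using \<Lambda> less_sqrt2_minus_1_iff[of \<Lambda>] by (simp add: \<kappa>_def \<Lambda>_def)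
  qed
  have x_Suc: "x (Suc n) = metric_projection C (x n - lam *\<^sub>R B (u n))" for n
    using it by (simp add: filtered_iteration_def)
  have xC: "x n \<in> C" for n
    using it metric_projection_in[OF C] by (cases n) (auto simp: filtered_iteration_def)
  have proj: "(x (Suc n) - x n + lam *\<^sub>R B (u n)) \<bullet> (y - x (Suc n)) \<ge> 0" if "y \<in> C" for y n
    using metric_projection_obtuse[OF C that, of "x n - lam *\<^sub>R B (u n)"]
    by (simp add: x_Suc[symmetric] algebra_simps)
  have u_Suc: "u (Suc n) = x (Suc n) + (x (Suc n) - x n) - \<beta> (Suc n) *\<^sub>R (u n - x n)" for n
  proof -
    have "u (Suc n) = x (Suc n) + (1 - \<beta> (Suc n)) *\<^sub>R (x (Suc n) - x n)
        + \<beta> (Suc n) *\<^sub>R (x (Suc n) - u n)"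
      using it by (simp add: filtered_iteration_def)
    then show ?thesis by (simp add: algebra_simps)
  qed
  have lip: "norm (B v - B w) \<le> L * norm (v - w)" for v w
    using lipschitz_onD[OF B(2), of v w] by (simp add: dist_norm)
  have zC: "z \<in> C" and z_sol: "\<And>y. y \<in> C \<Longrightarrow> 0 \<le> B z \<bullet> (y - z)"
    using z by (auto simp: VI_solutions_def)
  have nonneg: "0 \<le> D n" "0 \<le> d n" "0 \<le> s n" "0 \<le> e n" "0 \<le> a n" for n
    using z_sol[OF xC] lam by (simp_all add: D_def d_def s_def e_def a_def)
  have key: "D (Suc (Suc n)) + \<Lambda> * s (Suc n) + a (Suc n) \<le> D (Suc n) + \<Lambda> * s n + a n
      - \<kappa> * d n - \<kappa> * s (Suc n) - a (Suc n) + \<beta> (Suc n) * (2 * s (Suc n) + 5 * e n + D n)" for n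
  proof -
    have "(B (u (Suc n)) - B z) \<bullet> (u (Suc n) - z) \<ge> 0" using B(1) by (simp add: monotone_operator_def)
    from reflected_gradient_step[OF proj[OF xC] proj[OF xC] proj[OF zC] u_Suc this lip lip
        \<beta>'(1) lam \<Lambda>_def \<Lambda>'(1,2) \<kappa>_def]
    show ?thesis unfolding D_def s_def a_def d_def e_def by (simp add: mult.assoc)
  qed
  have e_Suc: "e (Suc n) \<le> 2 * d n + e n / 8" for n
  proof -
    have "norm (u (Suc n) - x (Suc n)) \<le> norm (x (Suc n) - x n) + norm (\<beta> (Suc n) *\<^sub>R (u n - x n))"
      unfolding u_Suc using norm_triangle_ineq4[of "x (Suc n) - x n" "\<beta> (Suc n) *\<^sub>R (u n - x n)"] by simp
    also have "\<dots> \<le> norm (x (Suc n) - x n) + 1/4 * norm (u n - x n)"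
      using \<beta>'(1)[of "Suc n"] mult_right_mono[OF \<beta>'(2)[of "Suc n"] norm_ge_zero[of "u n - x n"]]
      by simp
    finally have "e (Suc n) \<le> (norm (x (Suc n) - x n) + 1/4 * norm (u n - x n))\<^sup>2"
      unfolding e_def by (intro power_mono) auto
    also have "\<dots> \<le> 2 * d n + e n / 8"
      unfolding d_def e_def
      using zero_le_power2[of "norm (x (Suc n) - x n) - 1/4 * norm (u n - x n)"]
      by (simp add: power2_eq_square algebra_simps)
    finally show ?thesis .
  qed
  \<comment> \<open>The error involves \<open>D n\<close> but \<open>V n\<close> contains
    \<open>D (Suc n)\<close>; the shift costs a multiple of \<open>d n\<close>.\<close>
  have D_le: "D n \<le> 2 * D (Suc n) + 2 * d n" for n
  proof -
    have "norm (x n - z) \<le> norm (x (Suc n) - z) + norm (x (Suc n) - x n)"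
      using norm_triangle_ineq4[of "x (Suc n) - z" "x (Suc n) - x n"] by simp
    then have "D n \<le> (norm (x (Suc n) - z) + norm (x (Suc n) - x n))\<^sup>2"
      unfolding D_def by (intro power_mono) auto
    also have "\<dots> \<le> 2 * D (Suc n) + 2 * d n"
      unfolding d_def D_def
      using zero_le_power2[of "norm (x (Suc n) - z) - norm (x (Suc n) - x n)"]
      by (simp add: power2_eq_square algebra_simps)
    finally show ?thesis .
  qed
  \<comment> \<open>The threshold comes from the budget of \<open>e n\<close>: \<kappa>/32 + 5
    \<kappa>/64 stays below the available \<kappa>/4 - \<kappa>/8.\<close>
  have "eventually (\<lambda>n. \<beta> n < \<kappa> / 64) sequentially"
    using summable_LIMSEQ_zero[OF \<beta>'(3)] \<Lambda>'(3) by (intro order_tendstoD) auto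
  then obtain N where N: "\<And>n. n \<ge> N \<Longrightarrow> \<beta> n < \<kappa> / 64"
    by (auto simp: eventually_sequentially)
  have step: "V (Suc n) \<le> (1 + 2 * \<beta> (Suc n)) * V n - \<tau> n" if "n \<ge> N" for n
  proof -
    define b where "b = \<beta> (Suc n)"
    have b: "0 \<le> b" "b \<le> \<kappa> / 64" unfolding b_def using \<beta>'(1) N[of "Suc n"] that by auto
    have "b * s (Suc n) \<le> \<kappa> / 64 * s (Suc n)" "b * e n \<le> \<kappa> / 64 * e n" "b * d n \<le> \<kappa> / 64 * d n"
      by (intro mult_right_mono b nonneg)+
    moreover have "b * D n \<le> 2 * (b * D (Suc n)) + 2 * (b * d n)"
      using mult_left_mono[OF D_le[of n] b(1)] by (simp add: algebra_simps)
    moreover have "\<kappa> / 4 * e (Suc n) \<le> \<kappa> / 2 * d n + \<kappa> / 32 * e n"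
      using mult_left_mono[OF e_Suc[of n], of "\<kappa> / 4"] \<Lambda>'(3) by (simp add: algebra_simps)
    moreover have "b * D (Suc n) \<le> b * V n"
      unfolding V_def using b \<Lambda>' nonneg by (intro mult_left_mono) auto
    moreover have "b * (2 * s (Suc n) + 5 * e n + D n) = 2 * (b * s (Suc n)) + 5 * (b * e n) + b * D n"
      by (simp add: algebra_simps)
    moreover have "0 \<le> \<kappa> * s (Suc n)" "0 \<le> \<kappa> * e n" "0 \<le> \<kappa> * d n" using \<Lambda>'(3) nonneg by simp_all
    moreover have "(1 + 2 * b) * V n = V n + 2 * (b * V n)" by (simp add: algebra_simps)
    moreover have "V n = D (Suc n) + \<Lambda> * s n + a n + \<kappa> / 4 * e n"
      "V (Suc n) = D (Suc (Suc n)) + \<Lambda> * s (Suc n) + a (Suc n) + \<kappa> / 4 * e (Suc n)"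
      "\<tau> n = \<kappa> / 4 * d n + \<kappa> / 8 * e n + a (Suc n)"
      by (simp_all only: V_def \<tau>_def)
    ultimately show ?thesis
      using key[of n] unfolding b_def[symmetric] by linarith
  qed
  have V: "0 \<le> V n" "0 \<le> \<tau> n" for n
    unfolding V_def \<tau>_def using \<Lambda>' nonneg by simp_all
  have sm: "summable (\<lambda>n. 2 * \<beta> (Suc n))"
    using \<beta>'(3) by (intro summable_mult) (simp add: summable_Suc_iff)
  have conv: "convergent V" "\<tau> \<longlonglongrightarrow> 0"
    using almost_decreasing_convergent[of V \<tau> "\<lambda>n. 2 * \<beta> (Suc n)" N, OF V _ sm step] \<beta>'(1) by auto
  have small: "f \<longlonglongrightarrow> 0" if "\<And>n. 0 \<le> f n" "\<And>n. c * f n \<le> \<tau> n" "0 < c" for f c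
  proof -
    have "(\<lambda>n. \<tau> n / c) \<longlonglongrightarrow> 0 / c" by (intro tendsto_intros conv) (use that in auto)
    moreover have "f n \<le> \<tau> n / c" for n using that(2)[of n] that(3) by (simp add: field_simps)
    ultimately show ?thesis
      using that(1) by (intro tendsto_sandwich[OF _ _ tendsto_const, of 0 f]) auto
  qed
  have \<tau>_ge: "\<kappa> / 4 * d n \<le> \<tau> n" "\<kappa> / 8 * e n \<le> \<tau> n" "1 * a (Suc n) \<le> \<tau> n" for n
  proof -
    have "0 \<le> \<kappa> / 4 * d n" "0 \<le> \<kappa> / 8 * e n" using \<Lambda>'(3) nonneg by simp_all
    then show "\<kappa> / 4 * d n \<le> \<tau> n" "\<kappa> / 8 * e n \<le> \<tau> n" "1 * a (Suc n) \<le> \<tau> n"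
      using nonneg(5)[of "Suc n"] unfolding \<tau>_def by linarith+
  qed
  have d0: "d \<longlonglongrightarrow> 0" by (rule small[OF nonneg(2) \<tau>_ge(1)]) (use \<Lambda>' in simp)
  have e0: "e \<longlonglongrightarrow> 0" by (rule small[OF nonneg(4) \<tau>_ge(2)]) (use \<Lambda>' in simp)
  have "(\<lambda>n. a (Suc n)) \<longlonglongrightarrow> 0" by (rule small[OF nonneg(5) \<tau>_ge(3)]) simp
  then have a0: "a \<longlonglongrightarrow> 0" by (simp add: filterlim_sequentially_Suc)
  show "(\<lambda>n. norm (x (Suc n) - x n)) \<longlonglongrightarrow> 0"
    using tendsto_real_sqrt[OF d0] by (simp add: d_def[abs_def])
  show "(\<lambda>n. norm (u n - x n)) \<longlonglongrightarrow> 0"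
    using tendsto_real_sqrt[OF e0] by (simp add: e_def[abs_def])
  have s0: "s \<longlonglongrightarrow> 0"
  proof (rule tendsto_sandwich[OF _ _ tendsto_const])
    have "s n \<le> 2 * d n + 2 * e n" for n
    proof -
      have "norm (x (Suc n) - u n) \<le> norm (x (Suc n) - x n) + norm (u n - x n)"
        using norm_triangle_ineq4[of "x (Suc n) - x n" "u n - x n"] by simp
      then have "s n \<le> (norm (x (Suc n) - x n) + norm (u n - x n))\<^sup>2"
        unfolding s_def by (intro power_mono) auto
      also have "\<dots> \<le> 2 * d n + 2 * e n"
        unfolding d_def e_def
        using zero_le_power2[of "norm (x (Suc n) - x n) - norm (u n - x n)"]
        by (simp add: power2_eq_square algebra_simps)
      finally show ?thesis .
    qed
    then show "eventually (\<lambda>n. s n \<le> 2 * d n + 2 * e n) sequentially" by simp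
    show "(\<lambda>n. 2 * d n + 2 * e n) \<longlonglongrightarrow> 0"
      using tendsto_add[OF tendsto_mult_left[OF d0, of 2] tendsto_mult_left[OF e0, of 2]] by simp
  qed (use nonneg in auto)
  \<comment> \<open>All parts of \<open>V\<close> except the distance to \<open>z\<close> vanish, so
    the distance inherits its limit.\<close>
  obtain l where "V \<longlonglongrightarrow> l" using conv(1) by (auto simp: convergent_def)
  then have "(\<lambda>n. V n - \<Lambda> * s n - a n - \<kappa> / 4 * e n) \<longlonglongrightarrow> l - \<Lambda> * 0 - 0 - \<kappa> / 4 * 0"
    by (intro tendsto_intros s0 a0 e0)
  then have "(\<lambda>n. D (Suc n)) \<longlonglongrightarrow> l" by (simp add: V_def)
  then show "convergent (\<lambda>n. (norm (x n - z))\<^sup>2)"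
    unfolding D_def[symmetric] by (auto simp: convergent_def filterlim_sequentially_Suc)
qed

section \<open>Identification of weak cluster points and conclusion\<close>

text \<open>Testing at \<open>p + t *\<^sub>R (y - p)\<close>, dividing by \<open>t\<close> and
  letting \<open>t\<close> tend to 0 moves the operator from the test point to
  \<open>p\<close>.\<close>

lemma minty_VI_solution:
  fixes B :: "'a::real_inner \<Rightarrow> 'a"
  assumes "convex C" "continuous_on UNIV B" "p \<in> C"
    and minty: "\<And>y. y \<in> C \<Longrightarrow> 0 \<le> B y \<bullet> (y - p)"
  shows "p \<in> VI_solutions C B"
proof -
  have "0 \<le> B p \<bullet> (y - p)" if y: "y \<in> C" for y
  proof -
    have nonneg: "0 \<le> B (p + t *\<^sub>R (y - p)) \<bullet> (y - p)" if t: "0 < t" "t < 1" for t :: real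
    proof -
      have "(1 - t) *\<^sub>R p + t *\<^sub>R y \<in> C" using assms(1,3) y t by (auto intro!: convexD)
      also have "(1 - t) *\<^sub>R p + t *\<^sub>R y = p + t *\<^sub>R (y - p)" by (simp add: algebra_simps)
      finally have "0 \<le> t * (B (p + t *\<^sub>R (y - p)) \<bullet> (y - p))" using minty by force
      then show ?thesis using t by (simp add: zero_le_mult_iff)
    qed
    have "((\<lambda>t::real. B (p + t *\<^sub>R (y - p)) \<bullet> (y - p)) \<longlongrightarrow> B (p + 0 *\<^sub>R (y - p)) \<bullet> (y - p)) (at_right 0)"
      by (intro tendsto_inner tendsto_const continuous_on_tendsto_compose[OF assms(2)] tendsto_intros)
        auto
    moreover have "eventually (\<lambda>t::real. 0 \<le> B (p + t *\<^sub>R (y - p)) \<bullet> (y - p)) (at_right 0)"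
      using nonneg by (intro eventually_at_rightI[of 0 1]) auto
    ultimately have "0 \<le> B (p + 0 *\<^sub>R (y - p)) \<bullet> (y - p)"
      by (intro tendsto_lowerbound[OF _ _ trivial_limit_at_right_real])
    then show ?thesis by simp
  qed
  then show ?thesis using assms(3) by (simp add: VI_solutions_def)
qed

text \<open>\<open>B (u n)\<close> need not converge along a weak limit. Monotonicity replaces it by
  the fixed vector \<open>B y\<close>, which yields Minty's inequality at \<open>p\<close>.\<close>

lemma filtered_iteration_cluster_point:
  fixes C :: "'a::{real_inner, complete_space} set"
  assumes C: "C \<noteq> {}" "closed C" "convex C" and B: "monotone_operator B" "L-lipschitz_on UNIV B"
    and lam: "lam > 0" and it: "filtered_iteration C B lam \<beta> x u"
    and bdd: "\<And>n. norm (x n) \<le> M"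
    and d0: "(\<lambda>n. norm (x (Suc n) - x n)) \<longlonglongrightarrow> 0" and e0: "(\<lambda>n. norm (u n - x n)) \<longlonglongrightarrow> 0"
    and G: "G \<noteq> bot" "G \<le> sequentially" and lim: "\<And>y. ((\<lambda>n. x n \<bullet> y) \<longlongrightarrow> p \<bullet> y) G"
  shows "p \<in> VI_solutions C B"
proof -
  have x_Suc: "x (Suc n) = metric_projection C (x n - lam *\<^sub>R B (u n))" for n
    using it by (simp add: filtered_iteration_def)
  have xC: "x n \<in> C" for n
    using it metric_projection_in[OF C] by (cases n) (auto simp: filtered_iteration_def)
  have L: "0 \<le> L" using B(2) by (rule lipschitz_on_nonneg)
  obtain E where E: "\<And>n. norm (u n - x n) \<le> E"
    using convergent_imp_Bseq[OF convergentI[OF e0]] by (auto simp: Bseq_def)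
  have Bu: "norm (B (u n)) \<le> norm (B 0) + L * (M + E)" for n
  proof -
    have "norm (B (u n) - B 0) \<le> L * norm (u n)"
      using lipschitz_onD[OF B(2), of "u n" 0] by (simp add: dist_norm)
    also have "norm (u n) \<le> M + E"
      using norm_triangle_sub[of "u n" "x n"] E[of n] bdd[of n] by simp
    then have "L * norm (u n) \<le> L * (M + E)" using L by (rule mult_left_mono)
    finally show ?thesis using norm_triangle_sub[of "B (u n)" "B 0"] by simp
  qed
  have "p \<in> C" by (rule closed_convex_weakly_closed[OF C(2,3) G(1) xC lim])
  moreover have "0 \<le> B y \<bullet> (y - p)" if y: "y \<in> C" for y
  proof -
    \<comment> \<open>Three vanishing errors: the displacement in the projection inequality,
      replacing \<open>x (Suc n)\<close> by \<open>u n\<close>, and replacing \<open>u n\<close> by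
      \<open>x n\<close>.\<close>
    define R where "R n = norm (x (Suc n) - x n) * (norm y + M) / lam
        + (norm (B 0) + L * (M + E)) * (norm (x (Suc n) - x n) + norm (u n - x n))
        + norm (B y) * norm (u n - x n)" for n
    have R0: "R \<longlonglongrightarrow> 0 * (norm y + M) / lam + (norm (B 0) + L * (M + E)) * (0 + 0) + norm (B y) * 0"
      unfolding R_def[abs_def] using lam by (intro tendsto_intros d0 e0) auto
    have "0 \<le> B y \<bullet> y - x n \<bullet> B y + R n" for n
    proof -
      have obtuse: "0 \<le> (x (Suc n) - x n) \<bullet> (y - x (Suc n)) + lam * (B (u n) \<bullet> (y - x (Suc n)))"
        using metric_projection_obtuse[OF C y, of "x n - lam *\<^sub>R B (u n)"]
        by (simp add: x_Suc[symmetric] diff_diff_eq2 inner_add_left inner_diff_left)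
      have "(x (Suc n) - x n) \<bullet> (y - x (Suc n)) \<le> norm (x (Suc n) - x n) * norm (y - x (Suc n))"
        by (rule norm_cauchy_schwarz)
      also have "\<dots> \<le> norm (x (Suc n) - x n) * (norm y + M)"
        using norm_triangle_ineq4[of y "x (Suc n)"] bdd[of "Suc n"] by (intro mult_left_mono) auto
      finally have "- (norm (x (Suc n) - x n) * (norm y + M)) \<le> lam * (B (u n) \<bullet> (y - x (Suc n)))"
        using obtuse by linarith
      then have 1: "- (norm (x (Suc n) - x n) * (norm y + M) / lam) \<le> B (u n) \<bullet> (y - x (Suc n))"
        using lam by (simp add: field_simps)
      have "- (B (u n) \<bullet> (x (Suc n) - u n)) \<le> norm (B (u n)) * norm (x (Suc n) - u n)"
        using Cauchy_Schwarz_ineq2[of "B (u n)" "x (Suc n) - u n"] by linarith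
      also have "\<dots> \<le> (norm (B 0) + L * (M + E)) * (norm (x (Suc n) - x n) + norm (u n - x n))"
        using norm_triangle_ineq4[of "x (Suc n) - x n" "u n - x n"] Bu[of n]
          order_trans[OF norm_ge_zero Bu[of n]]
        by (intro mult_mono) auto
      finally have 2: "- (B (u n) \<bullet> (x (Suc n) - u n)) \<le> \<dots>" .
      have "0 \<le> (B y - B (u n)) \<bullet> (y - u n)" using B(1) by (simp add: monotone_operator_def)
      then have 3: "B (u n) \<bullet> (y - x (Suc n)) + B (u n) \<bullet> (x (Suc n) - u n) \<le> B y \<bullet> (y - u n)"
        by (simp add: inner_diff_left inner_diff_right)
      have "B y \<bullet> (y - u n) = B y \<bullet> y - x n \<bullet> B y - B y \<bullet> (u n - x n)"
        by (simp add: inner_diff_right inner_commute)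
      moreover have "- (B y \<bullet> (u n - x n)) \<le> norm (B y) * norm (u n - x n)"
        using Cauchy_Schwarz_ineq2[of "B y" "u n - x n"] by linarith
      ultimately show ?thesis using 1 2 3 unfolding R_def by linarith
    qed
    moreover have "((\<lambda>n. B y \<bullet> y - x n \<bullet> B y + R n) \<longlongrightarrow> B y \<bullet> y - p \<bullet> B y + 0) G"
      using tendsto_mono[OF G(2) R0] by (intro tendsto_intros lim) simp
    ultimately have "0 \<le> B y \<bullet> y - p \<bullet> B y + 0"
      by (intro tendsto_lowerbound[OF _ _ G(1)]) auto
    then show ?thesis by (simp add: inner_diff_right inner_commute)
  qed
  ultimately show ?thesis
    using minty_VI_solution[OF C(3) lipschitz_on_continuous_on[OF B(2)]] by blast
qed

lemma filtered_iteration_converges: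
  fixes C :: "'a::{real_inner, complete_space} set"
  assumes C: "C \<noteq> {}" "closed C" "convex C" and B: "monotone_operator B" "L-lipschitz_on UNIV B"
    and S: "VI_solutions C B \<noteq> {}"
    and \<beta>: "admissible_filter \<beta>" and lam: "lam > 0" and \<Lambda>: "lam * L < sqrt 2 - 1"
    and it: "filtered_iteration C B lam \<beta> x u"
  shows "\<exists>p \<in> VI_solutions C B. weakly_converges_to x p"
    and "(\<lambda>n. norm (x (Suc n) - x n)) \<longlonglongrightarrow> 0"
    and "(\<lambda>n. norm (u n - x n)) \<longlonglongrightarrow> 0"
proof -
  note fejer = filtered_iteration_fejer[OF C B \<beta> lam \<Lambda> it]
  obtain z where z: "z \<in> VI_solutions C B" using S by blast
  show d0: "(\<lambda>n. norm (x (Suc n) - x n)) \<longlonglongrightarrow> 0" and e0: "(\<lambda>n. norm (u n - x n)) \<longlonglongrightarrow> 0"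
    by (rule fejer[OF z])+
  obtain c where c: "\<And>n. (norm (x n - z))\<^sup>2 \<le> c"
    using convergent_imp_Bseq[OF fejer(1)[OF z]] by (auto simp: Bseq_def)
  have "norm (x n) \<le> norm z + sqrt c" for n
    using norm_triangle_sub[of "x n" z] real_le_rsqrt[OF c[of n]] by simp
  note cluster = filtered_iteration_cluster_point[OF C B lam it this d0 e0]
  show "\<exists>p \<in> VI_solutions C B. weakly_converges_to x p"
    by (rule opial_weak_convergence[OF S fejer(1) cluster])
qed

text \<open>The sharp cutoff is the equivalence with \<Lambda> \<le> \<open>c\<close>. The limit of
  small filters is stated as inclusions of intervals, uniformly over all filters whose sums stay
  below a common \<open>K\<close>.\<close>

theorem theorem5p5:
  fixes C :: "'a::{real_inner, complete_space} set"
    and B :: "'a \<Rightarrow> 'a"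
    and L lam :: real
    and \<beta> :: "nat \<Rightarrow> real"
    and x u :: "nat \<Rightarrow> 'a"
  shows
    "(C \<noteq> {} \<and> closed C \<and> convex C \<and>
      monotone_operator B \<and> L-lipschitz_on UNIV B \<and> VI_solutions C B \<noteq> {} \<and>
      admissible_filter \<beta> \<and> lam > 0 \<and>
      filtered_iteration C B lam \<beta> x u \<and>
      certificate \<beta> (lam * L)
      \<longrightarrow> (\<exists>p \<in> VI_solutions C B. weakly_converges_to x p) \<and>
          (\<lambda>n. norm (x (Suc n) - x n)) \<longlonglongrightarrow> 0 \<and>
          (\<lambda>n. norm (u n - x n)) \<longlonglongrightarrow> 0)
     \<and>
     (admissible_filter quadratic_filter \<and>
      (\<forall>\<Lambda>. 0 \<le> \<Lambda> \<and> \<Lambda> \<le> 0.387 \<longrightarrow> certificate quadratic_filter \<Lambda>) \<and>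
      (\<exists>c. \<bar>c - 0.3879\<bar> \<le> 0.00005 \<and>
           (\<forall>\<Lambda>\<ge>0. certificate quadratic_filter \<Lambda> \<longleftrightarrow> \<Lambda> \<le> c)))
     \<and>
     (\<forall>M>0. \<forall>K. \<forall>\<epsilon>>0. \<exists>\<delta>>0. \<forall>b.
        admissible_filter b \<and> (\<Sum>n. b n) \<le> K \<and> filter_sup b < \<delta> \<longrightarrow>
          {0<..(sqrt 2 - 1) / M - \<epsilon>} \<subseteq> certified_range b M \<and>
          certified_range b M \<subseteq> {0<..<(sqrt 2 - 1) / M})"
proof (intro conjI)
  show "C \<noteq> {} \<and> closed C \<and> convex C \<and>
      monotone_operator B \<and> L-lipschitz_on UNIV B \<and> VI_solutions C B \<noteq> {} \<and>
      admissible_filter \<beta> \<and> lam > 0 \<and>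
      filtered_iteration C B lam \<beta> x u \<and>
      certificate \<beta> (lam * L)
      \<longrightarrow> (\<exists>p \<in> VI_solutions C B. weakly_converges_to x p) \<and>
          (\<lambda>n. norm (x (Suc n) - x n)) \<longlonglongrightarrow> 0 \<and>
          (\<lambda>n. norm (u n - x n)) \<longlonglongrightarrow> 0"
    by (intro impI conjI; elim conjE; rule filtered_iteration_converges[of C B L \<beta> lam x u])
      (simp_all add: certificate_def)
  obtain c where c: "0.387 \<le> c" "\<bar>c - 0.3879\<bar> \<le> 0.00005"
    "\<And>\<Lambda>. 0 \<le> \<Lambda> \<Longrightarrow> certificate quadratic_filter \<Lambda> \<longleftrightarrow> \<Lambda> \<le> c"
    by (rule quadratic_filter_cutoff) blast
  show "admissible_filter quadratic_filter" by (rule admissible_quadratic_filter)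
  show "\<forall>\<Lambda>. 0 \<le> \<Lambda> \<and> \<Lambda> \<le> 0.387 \<longrightarrow> certificate quadratic_filter \<Lambda>"
    using c(1,3) order_trans by blast
  show "\<exists>c. \<bar>c - 0.3879\<bar> \<le> 0.00005 \<and>
           (\<forall>\<Lambda>\<ge>0. certificate quadratic_filter \<Lambda> \<longleftrightarrow> \<Lambda> \<le> c)"
    using c(2,3) by blast
  show "\<forall>M>0. \<forall>K. \<forall>\<epsilon>>0. \<exists>\<delta>>0. \<forall>b.
        admissible_filter b \<and> (\<Sum>n. b n) \<le> K \<and> filter_sup b < \<delta> \<longrightarrow>
          {0<..(sqrt 2 - 1) / M - \<epsilon>} \<subseteq> certified_range b M \<and>
          certified_range b M \<subseteq> {0<..<(sqrt 2 - 1) / M}"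
  proof (intro allI impI)
    fix M K \<epsilon> :: real
    assume "0 < M" "0 < \<epsilon>"
    then obtain \<delta> where "0 < \<delta>"
      "\<And>b. admissible_filter b \<Longrightarrow> suminf b \<le> K \<Longrightarrow> filter_sup b < \<delta> \<Longrightarrow>
         {0<..(sqrt 2 - 1) / M - \<epsilon>} \<subseteq> certified_range b M"
      using certified_range_bounds[of M \<epsilon> K] by blast
    then show "\<exists>\<delta>>0. \<forall>b. admissible_filter b \<and> (\<Sum>n. b n) \<le> K \<and> filter_sup b < \<delta> \<longrightarrow>
          {0<..(sqrt 2 - 1) / M - \<epsilon>} \<subseteq> certified_range b M \<and>
          certified_range b M \<subseteq> {0<..<(sqrt 2 - 1) / M}"
      using certified_range_subset[OF \<open>0 < M\<close>] by blast
  qed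
qed

end
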